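(* Let $d\ge 2$ and $c_0>0$. Write $B_a\subset\mathbb{R}^{d-1}$ for the closed ball of radius $a$ centred at $0$. The notion "is not determined by particles" is made precise in the context. 1. Let $\beta>-1$. There are positive constants $c'_1,\tilde c'_1,c'_2,\tilde c'_2$ depending only on $d,\beta,c_0$ such that for all $R',r'$ with $R'-r'>0$ and $r'\ge 1/3$, $$\mathbb P\big(\widetilde{\mathcal D}_\beta\cap(\mathbb{R}^{d-1}\setminus B_{R'})\text{ is not determined by particles }(v,h)\in\partial\Psi(\eta_\beta)\text{ with }v\in\mathbb{R}^{d-1}\setminus B_{R'-r'}\big)$$ $$<\begin{cases}c'_2\,r'\,e^{-c'_1(r')^{d+1+2\beta}}&: r'\ge c_0(R'-r'),\\ \tilde c'_2\,(R'-r')^{d-2}(r')^{-d+3}e^{-\tilde c'_1(r')^{d+1+2\beta}}&: r'<c_0(R'-r').\end{cases}$$ 2. Let $\beta>(d+1)/2$. There are positive constants $c'_3,\tilde c'_3$ depending only on $d,\beta,c_0$ such that for all $R',r'$ with $R'-r'>0$ and $r'>0$, $$\mathbb P\big(\widetilde{\mathcal D}'_\beta\cap(\mathbb{R}^{d-1}\setminus B_{R'})\text{ is not determined by particles }(v,h)\in\partial\Psi(\eta'_\beta)\text{ with }v\in\mathbb{R}^{d-1}\setminus B_{R'-r'}\big)$$ $$<\begin{cases}c'_3\,(r')^{-(2\beta-d-1)}&: r'\ge c_0(R'-r'),\\ \tilde c'_3\,(R'-r')^{d-2}(r')^{-2\beta+3}&: r'<c_0(R'-r').\end{cases}$$ 3.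 There are positive constants $c'_4,\tilde c'_4,c'_5,\tilde c'_5$ depending only on $d,c_0$ such that for all $R',r'$ with $R'-r'>0$ and $r'\ge 1/3$, $$\mathbb P\big(\widetilde{\mathcal D}\cap(\mathbb{R}^{d-1}\setminus B_{R'})\text{ is not determined by particles }(v,h)\in\partial\Psi(\zeta)\text{ with }v\in\mathbb{R}^{d-1}\setminus B_{R'-r'}\big)$$ $$<\begin{cases}c'_5\,e^{-c'_4(r')^2}&: r'\ge c_0(R'-r'),\\ \tilde c'_5\,(R'-r')^{d-2}(r')^{-d+2}e^{-\tilde c'_4(r')^2}&: r'<c_0(R'-r').\end{cases}$$
   Context: Let $d\ge 2$; points of $\mathbb{R}^d=\mathbb{R}^{d-1}\times\mathbb{R}$ are written $(v,h)$ with spatial coordinate $v\in\mathbb{R}^{d-1}$ and height $h\in\mathbb{R}$. Poisson processes. For $\beta>-1$, $\eta_\beta$ is the Poisson point process on $\mathbb{R}^{d-1}\times[0,\infty)$ whose intensity measure has Lebesgue density $(v,h)\mapsto c_{d,\beta}h^\beta$, $c_{d,\beta}=\frac{\Gamma(\frac d2+\beta+1)}{\pi^{d/2}\Gamma(\beta+1)}$. For $\beta>(d+1)/2$, $\eta'_\beta$ is the Poisson point process on $\mathbb{R}^{d-1}\times(-\infty,0]$ with intensity density $(v,h)\mapsto c'_{d,\beta}(-h)^{-\beta}$, $c'_{d,\beta}=\frac{\Gamma(\beta)}{\pi^{d/2}\Gamma(\beta-\frac d2)}$. Finally, $\zeta$ is the Poisson point process on $\mathbb{R}^{d-1}\times\mathbb{R}$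 with intensity density $(v,h)\mapsto (2\pi)^{-d/2}e^{h/2}$. Let $\xi$ be one of $\eta_\beta,\eta'_\beta,\zeta$. The paraboloid growth process is $\Psi(\xi)=\bigcup_{(v,h)\in\xi}\{(v',h'):h'\ge h+\|v'-v\|^2\}$, with topological boundary $\partial\Psi(\xi)$. Tessellations. Almost surely, any $d$ distinct points $x_1=(v_1,h_1),\dots,x_d=(v_d,h_d)$ of $\xi$ have affinely independent spatial coordinates, and there is a unique translate $\Pi(x_1,\dots,x_d)=\{(v,h):h=h'-\|v-v'\|^2\}$ of the standard downward paraboloid containing them. If no point of $\xi$ lies strictly below it, i.e. in $\{(v,h):h<h'-\|v-v'\|^2\}$, then $\Pi(x_1,\dots,x_d)\cap(\mathrm{conv}(v_1,\dots,v_d)\times\mathbb{R})$ is called a paraboloid facet (of the paraboloid hull of $\xi$) with vertices $x_1,\dots,x_d$, and $\mathrm{conv}(v_1,\dots,v_d)$ is declared a cell. Almost surely these cells form a stationary random simplicial tessellation of $\mathbb{R}^{d-1}$; the union of all cell boundaries (its skeleton) is a random closed set denoted $\widetilde{\mathcal D}_\beta$ for $\xi=\eta_\beta$, $\widetilde{\mathcal D}'_\beta$ for $\xi=\eta'_\beta$ and $\widetilde{\mathcal D}$ for $\xi=\zeta$. Determination. The event that the tessellation within $\mathbb{R}^{d-1}\setminus B_{R'}$ is not determined by particles $(v,h)\in\partial\Psi(\xi)$ with $v\in\mathbb{R}^{d-1}\setminus B_{R'-r'}$ (intuitively: that the tessellation outside $B_{R'}$ is affected by the points of $\xi$ inside $B_{R'-r'}\times\mathbb{R}$)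 is the event that there is a paraboloid facet which hits $(\mathbb{R}^{d-1}\setminus B_{R'})\times\mathbb{R}$ and has a vertex $(v,h)$ with $v\in B_{R'-r'}$. *)

theory Defs
  imports "HOL-Probability.Probability"
begin

text \<open>Points of $d$-dimensional space are pairs of type \<^typ>\<open>(real^'n) \<times> real\<close>, where
  $d = $ \<open>CARD('n) + 1\<close>: a spatial coordinate followed by a height.\<close>

definition num_points :: "('w \<Rightarrow> 'a set) \<Rightarrow> 'a set \<Rightarrow> 'w \<Rightarrow> ennreal" where
  "num_points \<xi> B \<omega> = emeasure (count_space UNIV) (\<xi> \<omega> \<inter> B)"

text \<open>Poisson processes are modelled as random sets. This is adequate for diffuse intensity
  measures, for which the process has no multiple points almost surely. Regions of infinite
  intensity are allowed: the intensity \<open>eta'_intensity\<close> below is not locally finite at height $0$.\<close>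

definition poisson_process :: "'w measure \<Rightarrow> 'a measure \<Rightarrow> ('w \<Rightarrow> 'a set) \<Rightarrow> bool" where
  "poisson_process M \<mu> \<xi> \<longleftrightarrow>
     prob_space M \<and>
     (\<forall>\<omega>\<in>space M. \<xi> \<omega> \<subseteq> space \<mu>) \<and>
     (\<forall>B\<in>sets \<mu>. num_points \<xi> B \<in> borel_measurable M) \<and>
     (\<forall>B\<in>sets \<mu>. emeasure \<mu> B < \<infinity> \<longrightarrow>
        (\<forall>k::nat. measure M {\<omega>\<in>space M. num_points \<xi> B \<omega> = of_nat k} =
           measure \<mu> B ^ k / fact k * exp (- measure \<mu> B))) \<and>
     (\<forall>B\<in>sets \<mu>. emeasure \<mu> B = \<infinity> \<longrightarrow> (AE \<omega> in M. num_points \<xi> B \<omega> = \<infinity>)) \<and>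
     (\<forall>(m::nat) B. B ` {..<m} \<subseteq> sets \<mu> \<longrightarrow> disjoint_family_on B {..<m} \<longrightarrow>
        prob_space.indep_vars M (\<lambda>_. borel) (\<lambda>i. num_points \<xi> (B i)) {..<m})"

definition eta_const :: "nat \<Rightarrow> real \<Rightarrow> real" where
  "eta_const d \<beta> = Gamma (real d / 2 + \<beta> + 1) / (pi powr (real d / 2) * Gamma (\<beta> + 1))"

definition eta'_const :: "nat \<Rightarrow> real \<Rightarrow> real" where
  "eta'_const d \<beta> = Gamma \<beta> / (pi powr (real d / 2) * Gamma (\<beta> - real d / 2))"

definition eta_intensity :: "real \<Rightarrow> ((real^'n::finite) \<times> real) measure" where
  "eta_intensity \<beta> = density (restrict_space lborel (UNIV \<times> {0..}))
     (\<lambda>(v, h). ennreal (eta_const (CARD('n) + 1) \<beta> * h powr \<beta>))"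

definition eta'_intensity :: "real \<Rightarrow> ((real^'n::finite) \<times> real) measure" where
  "eta'_intensity \<beta> = density (restrict_space lborel (UNIV \<times> {..0}))
     (\<lambda>(v, h). ennreal (eta'_const (CARD('n) + 1) \<beta> * (- h) powr (- \<beta>)))"

definition zeta_intensity :: "((real^'n::finite) \<times> real) measure" where
  "zeta_intensity = density lborel
     (\<lambda>(v, h). ennreal ((2 * pi) powr (- real (CARD('n) + 1) / 2) * exp (h / 2)))"

definition paraboloid :: "(real^'n::finite) \<times> real \<Rightarrow> ((real^'n) \<times> real) set" where
  "paraboloid = (\<lambda>(v', h'). {(v, h). h = h' - (norm (v - v'))\<^sup>2})"

definition below_paraboloid :: "(real^'n::finite) \<times> real \<Rightarrow> ((real^'n) \<times> real) set" where
  "below_paraboloid = (\<lambda>(v', h'). {(v, h). h < h' - (norm (v - v'))\<^sup>2})"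

text \<open>\<open>paraboloid_facet P X F\<close>: \<open>F\<close> is a facet of the paraboloid hull of \<open>P\<close> with vertex set \<open>X\<close>.
  Distinct points of a paraboloid have distinct spatial coordinates, so \<open>fst ` X\<close> consists of
  $d$ points; by affine independence the apex \<open>p\<close> is unique.\<close>

definition paraboloid_facet ::
  "((real^'n::finite) \<times> real) set \<Rightarrow> ((real^'n) \<times> real) set \<Rightarrow> ((real^'n) \<times> real) set \<Rightarrow> bool" where
  "paraboloid_facet P X F \<longleftrightarrow>
     X \<subseteq> P \<and> card X = CARD('n) + 1 \<and> \<not> affine_dependent (fst ` X) \<and>
     (\<exists>p. X \<subseteq> paraboloid p \<and> P \<inter> below_paraboloid p = {} \<and>
          F = paraboloid p \<inter> (convex hull (fst ` X) \<times> UNIV))"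

text \<open>The event that the tessellation outside the ball of radius \<open>R\<close> is not determined by the
  particles whose spatial coordinates lie outside the ball of radius \<open>R - r\<close>.\<close>

definition not_determined ::
  "'w measure \<Rightarrow> ('w \<Rightarrow> ((real^'n::finite) \<times> real) set) \<Rightarrow> real \<Rightarrow> real \<Rightarrow> 'w set" where
  "not_determined M \<xi> R r =
     {\<omega>\<in>space M. \<exists>X F. paraboloid_facet (\<xi> \<omega>) X F \<and>
        F \<inter> ((- cball 0 R) \<times> UNIV) \<noteq> {} \<and> (\<exists>(v, h)\<in>X. v \<in> cball 0 (R - r))}"

text \<open>The facet structure is controlled by the counts only almost surely, hence the completion.
  The measurability clause matters: non-measurable sets have \<^const>\<open>measure\<close> zero.\<close>

definition event_prob_less :: "'w measure \<Rightarrow> 'w set \<Rightarrow> real \<Rightarrow> bool" where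
  "event_prob_less M E b \<longleftrightarrow> E \<in> sets (completion M) \<and> measure (completion M) E < b"

end

theory Submission
  imports Defs "HOL-Real_Asymp.Real_Asymp"
begin

text \<open>The paraboloid is measured against height 0. Concavity compares it only with the chord
  joining the two vertices, and where negative heights are occupied a deep vertex can drag that
  chord down; hence the low region. Unlike the existence of a facet, both alternatives are
  statements about counts on fixed Borel sets, which is what makes a union bound over the net
  possible. The size of the net is also the origin of the two cases of each bound: with
  \<open>s = (R - r) / r\<close>, the factor \<open>(s + 2) ^ (d - 2)\<close> is bounded when
  \<open>r \<ge> c0 * (R - r)\<close> and is at most a constant times \<open>s ^ (d - 2)\<close>
  otherwise. A separate obstacle is measurability. The process is accessible only through its counts
  on Borel sets, while the event quantifies over finite subsets of an uncountable space. Facets are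
  therefore coded by tuples of points: the conditions on a tuple are Borel because they are built
  from projections of sigma-compact sets, and the random points themselves are listed by measurable
  functions.\<close>

text \<open>Let \<open>f x = k - (norm (x - c))\<^sup>2\<close> be the empty paraboloid of a facet that has one vertex with spatial
  coordinate \<open>v\<close> in the ball of radius \<open>R - r\<close> and reaches outside the ball of radius \<open>R\<close>, hence another
  vertex with spatial coordinate \<open>w\<close> outside that ball. Let \<open>u\<close> be the point of norm \<open>R - r / 2\<close> on the
  segment between \<open>v\<close> and \<open>w\<close>; both have distance at least \<open>r / 2\<close> from it. Either one of the two vertices
  is very low, \<open>f x < - (norm (x - u))\<^sup>2 / 2\<close>, or strict concavity of \<open>f\<close> gives \<open>f u \<ge> r\<^sup>2 / 8\<close>, and then
  \<open>f \<ge> r\<^sup>2 / 16\<close> on a ball of radius \<open>r / 8\<close>, so that a cylinder over this ball contains no points.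
  Replacing the ball and \<open>u\<close> by the elements of a net of the annulus, of size
  \<open>O(((R - r) / r + 2) ^ (d - 2))\<close>, bounds the probability by the size of the net times
  \<open>exp (- intensity of the cylinder) + intensity of the low region\<close>.
  For the first process the low region is void, for the second the cylinder has infinite intensity.\<close>

section \<open>Facets of large extent\<close>

text \<open>Stewart's theorem in vector form. The last term is the amount by which a paraboloid
  exceeds its chord.\<close>

lemma norm_diff_segment:
  fixes a b c :: "'a::real_inner"
  shows "(norm ((1 - t) *\<^sub>R a + t *\<^sub>R b - c))\<^sup>2 =
    (1 - t) * (norm (a - c))\<^sup>2 + t * (norm (b - c))\<^sup>2 - t * (1 - t) * (norm (a - b))\<^sup>2"
  unfolding power2_norm_eq_inner
  by (simp add: inner_diff_left inner_diff_right inner_add_left inner_add_right inner_commute)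
     (simp add: algebra_simps)

lemma segment_meets_sphere:
  fixes a b :: "'a::real_normed_vector"
  assumes "norm a \<le> s" "s \<le> norm b"
  obtains t where "0 \<le> t" "t \<le> 1" "norm ((1 - t) *\<^sub>R a + t *\<^sub>R b) = s"
proof -
  have "\<exists>t. 0 \<le> t \<and> t \<le> 1 \<and> norm ((1 - t) *\<^sub>R a + t *\<^sub>R b) = s"
    by (rule IVT') (use assms in \<open>auto intro!: continuous_intros\<close>)
  then show ?thesis using that by blast
qed

lemma convex_hull_not_in_cball:
  fixes V :: "'a::real_normed_vector set"
  shows "convex hull V \<inter> - cball 0 R \<noteq> {} \<longleftrightarrow> (\<exists>v\<in>V. R < norm v)"
proof
  assume "convex hull V \<inter> - cball 0 R \<noteq> {}"
  then have "\<not> convex hull V \<subseteq> cball 0 R" by blast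
  then have "\<not> V \<subseteq> cball 0 R" by (metis convex_cball hull_minimal)
  then show "\<exists>v\<in>V. R < norm v" by (auto simp: subset_eq not_le)
next
  assume "\<exists>v\<in>V. R < norm v"
  then obtain v where "v \<in> convex hull V" "R < norm v" by (meson hull_inc)
  then show "convex hull V \<inter> - cball 0 R \<noteq> {}" by auto
qed

text \<open>At \<open>u\<close> the paraboloid exceeds its chord by exactly
  \<open>norm (a - u) * norm (b - u)\<close>. The two lower bounds at the endpoints cost at most
  half of this product when averaged along the chord, because their weights \<open>t\<close> and
  \<open>1 - t\<close> add up to 1; the other half is at least \<open>r\<^sup>2 / 8\<close>.\<close>

lemma paraboloid_high_between:
  fixes a b c u :: "real^'n::finite"
  assumes u: "u = (1 - t) *\<^sub>R a + t *\<^sub>R b" and t: "0 \<le> t" "t \<le> 1"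
    and "r \<ge> 0" "norm (a - u) \<ge> r / 2" "norm (b - u) \<ge> r / 2"
    and a: "h - (norm (a - c))\<^sup>2 \<ge> - (norm (a - u))\<^sup>2 / 2"
    and b: "h - (norm (b - c))\<^sup>2 \<ge> - (norm (b - u))\<^sup>2 / 2"
  shows "h - (norm (u - c))\<^sup>2 \<ge> r\<^sup>2 / 8"
proof -
  define L where "L = norm (a - b)"
  have "a - u = t *\<^sub>R (a - b)" "b - u = (1 - t) *\<^sub>R (b - a)"
    by (simp_all add: u algebra_simps)
  then have au: "norm (a - u) = t * L" and bu: "norm (b - u) = (1 - t) * L"
    using t by (simp_all add: L_def norm_minus_commute)
  have "(1 - t) * (h - (norm (a - c))\<^sup>2) + t * (h - (norm (b - c))\<^sup>2)
      \<ge> (1 - t) * (- (t * L)\<^sup>2 / 2) + t * (- ((1 - t) * L)\<^sup>2 / 2)"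
    using a b t unfolding au bu by (intro add_mono mult_left_mono) auto
  moreover have "(1 - t) * (- (t * L)\<^sup>2 / 2) + t * (- ((1 - t) * L)\<^sup>2 / 2) + t * (1 - t) * L\<^sup>2
      = (t * L) * ((1 - t) * L) / 2"
    by (simp add: field_simps power2_eq_square)
  moreover have "(t * L) * ((1 - t) * L) \<ge> (r / 2) * (r / 2)"
    using assms(4-6) unfolding au bu by (intro mult_mono) auto
  moreover have "h - (norm (u - c))\<^sup>2 = (1 - t) * (h - (norm (a - c))\<^sup>2) + t * (h - (norm (b - c))\<^sup>2)
      + t * (1 - t) * L\<^sup>2"
    unfolding u norm_diff_segment by (simp add: L_def algebra_simps)
  moreover have "(r / 2) * (r / 2) = r\<^sup>2 / 4" by (simp add: power2_eq_square)
  ultimately show ?thesis by linarith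
qed

text \<open>The ball is shifted from \<open>u\<close> towards the apex until it touches
  \<open>u\<close>. On it the first-order term \<open>(x - u) \<bullet> (c - u)\<close> is
  nonnegative, so only the quadratic term is lost, and this is at most
  \<open>(r / 4)\<^sup>2 = r\<^sup>2 / 16\<close>.\<close>

lemma paraboloid_above_cylinder:
  fixes c u :: "real^'n::finite"
  assumes "r \<ge> 0" and u: "h - (norm (u - c))\<^sup>2 \<ge> r\<^sup>2 / 8"
  obtains y where "norm (y - u) = r / 8"
    "\<And>x. norm (x - y) \<le> r / 8 \<Longrightarrow> h - (norm (x - c))\<^sup>2 \<ge> r\<^sup>2 / 16"
proof -
  \<comment> \<open>The unit direction towards the apex. If \<open>u\<close> already lies under the
    apex, every direction serves and a coordinate vector is taken.\<close>
  obtain e :: "real^'n" where e: "norm e = 1" "e \<bullet> (c - u) = norm (c - u)"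
  proof (cases "c = u")
    case True
    then show thesis using that[of "axis undefined 1"] by (simp add: norm_axis_1)
  next
    case False
    have "sgn (c - u) \<bullet> (c - u) = norm (c - u)"
      using False unfolding sgn_div_norm by (simp add: dot_square_norm power2_eq_square)
    then show thesis using that[of "sgn (c - u)"] False by (simp add: norm_sgn)
  qed
  define y where "y = u + (r / 8) *\<^sub>R e"
  show thesis
  proof (rule that)
    show "norm (y - u) = r / 8" using e \<open>r \<ge> 0\<close> by (simp add: y_def)
    fix x assume x: "norm (x - y) \<le> r / 8"
    have "(x - u) \<bullet> (c - u) = (x - y) \<bullet> (c - u) + r / 8 * norm (c - u)"
      using e by (simp add: y_def inner_diff_left inner_add_left algebra_simps)
    moreover have "\<bar>(x - y) \<bullet> (c - u)\<bar> \<le> norm (x - y) * norm (c - u)"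
      by (rule Cauchy_Schwarz_ineq2)
    moreover have "norm (x - y) * norm (c - u) \<le> r / 8 * norm (c - u)"
      using x by (intro mult_right_mono) auto
    ultimately have "(x - u) \<bullet> (c - u) \<ge> 0" by linarith
    moreover have "(norm (x - u))\<^sup>2 \<le> (r / 4)\<^sup>2"
      using norm_triangle_ineq[of "x - y" "y - u"] x \<open>norm (y - u) = r / 8\<close>
      by (intro power_mono) auto
    moreover have "(norm (x - c))\<^sup>2 = (norm (u - c))\<^sup>2 + (norm (x - u))\<^sup>2 - 2 * ((x - u) \<bullet> (c - u))"
      unfolding power2_norm_eq_inner
      by (simp add: inner_diff_left inner_diff_right inner_commute)
    ultimately show "h - (norm (x - c))\<^sup>2 \<ge> r\<^sup>2 / 16"
      using u by (simp add: power2_eq_square)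
  qed
qed

text \<open>The radius is half of the \<open>r / 8\<close> available below the paraboloid; the rest
  absorbs the mesh of the net. No lower end is imposed, so the cylinder also crosses height 0 from
  below, where the second intensity is infinite.\<close>

definition cylinder :: "real \<Rightarrow> real^'n::finite \<Rightarrow> ((real^'n) \<times> real) set" where
  "cylinder r y = cball y (r / 16) \<times> {..<r\<^sup>2 / 16}"

text \<open>The constants are weaker than those for a low vertex seen from \<open>u\<close>, namely
  distance \<open>r / 2\<close> and depth \<open>(norm (x - u))\<^sup>2 / 2\<close>, so that the
  centre may be moved by \<open>r / 16\<close> to a point of the net.\<close>

definition low_region :: "real \<Rightarrow> real^'n::finite \<Rightarrow> ((real^'n) \<times> real) set" where
  "low_region r y = {(x, h). r / 4 \<le> norm (x - y) \<and> h \<le> - (norm (x - y))\<^sup>2 / 16}"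

text \<open>Since \<open>hull\<close> binds less tightly than \<open>\<times>\<close>, the definition of a facet contains the convex hull of
  \<open>fst ` X \<times> UNIV\<close>.\<close>

lemma paraboloid_facet_iff:
  fixes P :: "((real^'n::finite) \<times> real) set"
  shows "paraboloid_facet P X F \<longleftrightarrow> X \<subseteq> P \<and> card X = CARD('n) + 1 \<and> \<not> affine_dependent (fst ` X) \<and>
     (\<exists>p. X \<subseteq> paraboloid p \<and> P \<inter> below_paraboloid p = {} \<and>
          F = paraboloid p \<inter> (convex hull (fst ` X)) \<times> UNIV)"
  unfolding paraboloid_facet_def convex_hull_Times by (simp add: hull_UNIV)

text \<open>A paraboloid is a graph over the whole spatial space, so a facet projects onto the full
  convex hull of its vertices; and a hull lies in a ball as soon as its vertices do.\<close>

lemma facet_hits_outside_iff: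
  fixes X :: "((real^'n::finite) \<times> real) set"
  assumes F: "F = paraboloid p \<inter> (convex hull (fst ` X)) \<times> UNIV"
  shows "F \<inter> ((- cball 0 R) \<times> UNIV) \<noteq> {} \<longleftrightarrow> (\<exists>z\<in>X. R < norm (fst z))"
proof -
  have "F \<inter> ((- cball 0 R) \<times> UNIV) \<noteq> {} \<longleftrightarrow> convex hull (fst ` X) \<inter> - cball 0 R \<noteq> {}"
  proof
    assume "F \<inter> ((- cball 0 R) \<times> UNIV) \<noteq> {}"
    then obtain q where "q \<in> F" "fst q \<in> - cball 0 R" by (auto simp: mem_Times_iff)
    then show "convex hull (fst ` X) \<inter> - cball 0 R \<noteq> {}" by (auto simp: F mem_Times_iff)
  next
    assume "convex hull (fst ` X) \<inter> - cball 0 R \<noteq> {}"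
    then obtain v where "v \<in> convex hull (fst ` X)" "v \<in> - cball 0 R" by blast
    then have "(v, snd p - (norm (v - fst p))\<^sup>2) \<in> F \<inter> ((- cball 0 R) \<times> UNIV)"
      by (simp add: F paraboloid_def case_prod_beta)
    then show "F \<inter> ((- cball 0 R) \<times> UNIV) \<noteq> {}" by blast
  qed
  then show ?thesis unfolding convex_hull_not_in_cball by simp
qed

lemma facet_forces_empty_cylinder_or_low_point:
  fixes P :: "((real^'n::finite) \<times> real) set"
  assumes facet: "paraboloid_facet P X F" and hits: "F \<inter> ((- cball 0 R) \<times> UNIV) \<noteq> {}"
    and vX: "(v, h) \<in> X" "v \<in> cball 0 (R - r)" and r: "r > 0"
    and net: "\<And>y. R - r \<le> norm y \<Longrightarrow> norm y \<le> R \<Longrightarrow> \<exists>z\<in>Y. norm (y - z) \<le> r / 16"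
  shows "\<exists>z\<in>Y. P \<inter> cylinder r z = {} \<or> P \<inter> low_region r z \<noteq> {}"
proof -
  obtain c k where X: "X \<subseteq> P" "X \<subseteq> paraboloid (c, k)" and empty: "P \<inter> below_paraboloid (c, k) = {}"
    and F: "F = paraboloid (c, k) \<inter> ((convex hull (fst ` X)) \<times> UNIV)"
    using facet unfolding paraboloid_facet_iff by auto
  obtain w l where wX: "(w, l) \<in> X" "norm w > R"
    using hits unfolding facet_hits_outside_iff[OF F] by auto
  have hl: "h = k - (norm (v - c))\<^sup>2" "l = k - (norm (w - c))\<^sup>2"
    using X(2) vX(1) wX(1) by (auto simp: paraboloid_def)
  obtain t where t: "0 \<le> t" "t \<le> 1" and nu: "norm ((1 - t) *\<^sub>R v + t *\<^sub>R w) = R - r / 2"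
    by (rule segment_meets_sphere[of v "R - r / 2" w]) (use vX wX r in auto)
  define u where "u = (1 - t) *\<^sub>R v + t *\<^sub>R w"
  have nu: "norm u = R - r / 2" using nu by (simp add: u_def)
  have dist: "norm (v - u) \<ge> r / 2" "norm (w - u) \<ge> r / 2"
    using norm_triangle_ineq2[of u v] norm_triangle_ineq2[of w u] nu vX(2) wX(2)
    by (simp_all add: norm_minus_commute)
  \<comment> \<open>Stated for an arbitrary vertex, since either of the two chosen vertices may be
    the deep one.\<close>
  have low: ?thesis if xh: "(x, h) \<in> X" "norm (x - u) \<ge> r / 2" "h < - (norm (x - u))\<^sup>2 / 2" for x h
  proof -
    obtain z where z: "z \<in> Y" "norm (u - z) \<le> r / 16" using net[of u] nu r by auto
    have n1: "norm (x - z) \<ge> norm (x - u) - r / 16" "norm (x - z) \<le> norm (x - u) + r / 16"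
      using norm_triangle_ineq[of "x - u" "u - z"] norm_triangle_ineq[of "x - z" "z - u"] z
      by (auto simp: norm_minus_commute)
    then have "norm (x - z) \<le> 2 * norm (x - u)" using xh r by linarith
    then have "(norm (x - z))\<^sup>2 \<le> (2 * norm (x - u))\<^sup>2" by (intro power_mono) auto
    then have "(norm (x - z))\<^sup>2 \<le> 4 * (norm (x - u))\<^sup>2" by (simp add: power_mult_distrib)
    then have "h \<le> - (norm (x - z))\<^sup>2 / 16"
      using xh(3) zero_le_power2[of "norm (x - u)"] by linarith
    then have "(x, h) \<in> P \<inter> low_region r z" using xh n1 r X by (auto simp: low_region_def)
    then show ?thesis using z by blast
  qed
  show ?thesis
  proof (cases "h < - (norm (v - u))\<^sup>2 / 2 \<or> l < - (norm (w - u))\<^sup>2 / 2")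
    case True
    then show ?thesis using low vX(1) wX(1) dist by blast
  next
    case False
    then have "k - (norm (u - c))\<^sup>2 \<ge> r\<^sup>2 / 8"
      by (intro paraboloid_high_between[OF u_def t]) (use r dist hl in auto)
    then obtain y where y: "norm (y - u) = r / 8"
      "\<And>x. norm (x - y) \<le> r / 8 \<Longrightarrow> k - (norm (x - c))\<^sup>2 \<ge> r\<^sup>2 / 16"
      using paraboloid_above_cylinder[OF less_imp_le[OF r]] by blast
    have "norm y \<le> R" "norm y \<ge> R - r"
      using norm_triangle_ineq2[of y u] norm_triangle_ineq2[of u y] nu y(1) r
      by (simp_all add: norm_minus_commute)
    then obtain z where z: "z \<in> Y" "norm (y - z) \<le> r / 16" using net by blast
    have "cylinder r z \<subseteq> below_paraboloid (c, k)"
    proof (rule subrelI)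
      fix x h assume "(x, h) \<in> cylinder r z"
      then have "norm (x - z) \<le> r / 16" "h < r\<^sup>2 / 16"
        by (auto simp: cylinder_def dist_norm norm_minus_commute)
      moreover have "norm (x - y) \<le> r / 8"
        using calculation z norm_triangle_ineq[of "x - z" "z - y"] by (simp add: norm_minus_commute)
      ultimately show "(x, h) \<in> below_paraboloid (c, k)"
        using y(2)[of x] by (simp add: below_paraboloid_def)
    qed
    then show ?thesis using z empty by blast
  qed
qed

section \<open>Nets of annuli\<close>

text \<open>A separated set of greatest cardinality is a net: a point at distance more than
  \<open>e\<close> from all its members could be added.\<close>

lemma maximal_separated_subset:
  fixes A :: "'a::metric_space set"
  assumes "e \<ge> 0" and bound: "\<And>Y. finite Y \<Longrightarrow> Y \<subseteq> A \<Longrightarrow> (\<forall>x\<in>Y. \<forall>y\<in>Y. x \<noteq> y \<longrightarrow> e < dist x y) \<Longrightarrow> card Y \<le> N"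
  obtains Y where "finite Y" "card Y \<le> N" "\<And>x. x \<in> A \<Longrightarrow> \<exists>y\<in>Y. dist x y \<le> e"
proof -
  define Q where "Q Y \<longleftrightarrow> finite Y \<and> Y \<subseteq> A \<and> (\<forall>x\<in>Y. \<forall>y\<in>Y. x \<noteq> y \<longrightarrow> e < dist x y)" for Y
  have "Q {}" by (simp add: Q_def)
  moreover have "\<forall>Y. Q Y \<longrightarrow> card Y < Suc N" using bound by (auto simp: Q_def less_Suc_eq_le)
  ultimately have "\<exists>Y. Q Y \<and> (\<forall>Z. Q Z \<longrightarrow> card Z \<le> card Y)"
    by (rule ex_has_greatest_nat)
  then obtain Y where Y: "Q Y" "\<And>Z. Q Z \<Longrightarrow> card Z \<le> card Y" by auto
  have "\<exists>y\<in>Y. dist x y \<le> e" if x: "x \<in> A" for x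
  proof (rule ccontr)
    assume "\<not> ?thesis"
    then have far: "\<And>y. y \<in> Y \<Longrightarrow> e < dist x y" by force
    then have "x \<notin> Y" using \<open>e \<ge> 0\<close> by force
    have "Q (insert x Y)" using Y(1) x far by (auto simp: Q_def dist_commute)
    then show False using Y(2)[of "insert x Y"] Y(1) \<open>x \<notin> Y\<close> by (auto simp: Q_def)
  qed
  then show thesis using that Y(1) bound by (auto simp: Q_def)
qed


text \<open>Applied to the volume of a spherical shell. Keeping the thickness \<open>a - b\<close>
  as a factor is what lowers the exponent in the size of the net from the dimension to one
  less.\<close>

lemma power_diff_le:
  fixes a b :: real
  assumes "0 \<le> b" "b \<le> a"
  shows "a ^ n - b ^ n \<le> real n * (a - b) * a ^ (n - 1)"
proof -
  have "a ^ n - b ^ n = (a - b) * (\<Sum>i<n. b ^ (n - Suc i) * a ^ i)"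
    by (rule power_diff_sumr2)
  also have "\<dots> \<le> (a - b) * (\<Sum>i<n. a ^ (n - 1))"
  proof (intro mult_left_mono sum_mono)
    fix i assume i: "i \<in> {..<n}"
    then have "b ^ (n - Suc i) * a ^ i \<le> a ^ (n - Suc i) * a ^ i"
      using assms by (intro mult_right_mono power_mono) auto
    also have "\<dots> = a ^ (n - 1)" using i by (simp flip: power_add)
    finally show "b ^ (n - Suc i) * a ^ i \<le> a ^ (n - 1)" .
  qed (use assms in auto)
  finally show ?thesis by (simp add: mult_ac)
qed

text \<open>Packing by volume: the balls of radius \<open>r / 32\<close> around the points are
  disjoint and lie in a shell of thickness at most \<open>3 * r\<close> and outer radius
  \<open>R + r\<close>.\<close>

lemma card_separated_in_annulus:
  fixes Y :: "('a::euclidean_space) set"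
  assumes "finite Y" and Y: "Y \<subseteq> {y. R - r \<le> norm y \<and> norm y \<le> R}"
    and sep: "\<forall>x\<in>Y. \<forall>y\<in>Y. x \<noteq> y \<longrightarrow> r / 16 < dist x y" and r: "0 < r" "r < R"
  shows "real (card Y) \<le> 3 * DIM('a) * 32 ^ DIM('a) * ((R - r) / r + 2) ^ (DIM('a) - 1)"
proof -
  define n where "n = DIM('a)"
  define V where "V = unit_ball_vol (real n)"
  have V: "V > 0" by (simp add: V_def)
  have n: "n > 0" by (simp add: n_def)
  \<comment> \<open>For \<open>R < 2 * r\<close> the shell degenerates to a full ball; its radius
    \<open>R + r\<close> is then still at most \<open>3 * r\<close>.\<close>
  define b where "b = max 0 (R - 2 * r)"
  let ?U = "\<Union>y\<in>Y. ball y (r / 32)"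
  have disj: "disjoint_family_on (\<lambda>y. ball y (r / 32)) Y"
    unfolding disjoint_family_on_def
  proof (intro ballI impI)
    fix x y assume xy: "x \<in> Y" "y \<in> Y" "x \<noteq> y"
    show "ball x (r / 32) \<inter> ball y (r / 32) = {}"
      using sep xy by (intro disjoint_ballI) force
  qed
  have "?U \<subseteq> cball 0 (R + r) - ball 0 b"
  proof safe
    fix y z assume "y \<in> Y" and z: "z \<in> ball y (r / 32)"
    then have y: "R - r \<le> norm y" "norm y \<le> R" using Y by auto
    have yz: "norm (y - z) < r / 32" "norm (z - y) < r / 32"
      using z by (auto simp: dist_norm norm_minus_commute)
    show "z \<in> cball 0 (R + r)" using norm_triangle_ineq2[of z y] y yz r by simp
    assume "z \<in> ball 0 b"
    then have "norm z < R - 2 * r" by (simp add: b_def less_max_iff_disj)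
    then show False using norm_triangle_ineq2[of y z] y yz r by simp
  qed
  moreover have "cball (0::'a) (R + r) - ball 0 b \<in> fmeasurable lborel"
    using r by (intro fmeasurable_Diff fmeasurableI) (auto simp: emeasure_cball)
  ultimately have "measure lborel ?U \<le> measure lborel (cball (0::'a) (R + r) - ball 0 b)"
    by (intro measure_mono_fmeasurable) (auto intro!: borel_open)
  also have "\<dots> = measure lborel (cball (0::'a) (R + r)) - measure lborel (ball (0::'a) b)"
    by (intro measure_Diff) (use r in \<open>auto simp: b_def emeasure_cball subset_eq\<close>)
  also have "\<dots> = V * ((R + r) ^ n - b ^ n)"
    using r by (simp add: content_cball content_ball b_def V_def n_def algebra_simps)
  also have "\<dots> \<le> V * (real n * (R + r - b) * (R + r) ^ (n - 1))"
    using V r by (intro mult_left_mono power_diff_le) (auto simp: b_def)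
  also have "\<dots> \<le> V * (real n * (3 * r) * (R + r) ^ (n - 1))"
    using V r by (intro mult_left_mono mult_right_mono) (auto simp: b_def)
  finally have "measure lborel ?U \<le> V * (real n * (3 * r) * (R + r) ^ (n - 1))" .
  moreover have "measure lborel ?U = (\<Sum>y\<in>Y. measure lborel (ball y (r / 32)))"
    by (rule measure_finite_Union[OF \<open>finite Y\<close> _ disj])
       (use r in \<open>auto simp: emeasure_ball\<close>)
  moreover have "\<dots> = card Y * (V * (r / 32) ^ n)"
    using r by (simp add: content_ball V_def n_def)
  ultimately have "V * (card Y * (r / 32) ^ n) \<le> V * (real n * (3 * r) * (R + r) ^ (n - 1))"
    by (simp add: mult_ac)
  then have "card Y * (r / 32) ^ n \<le> real n * (3 * r) * (R + r) ^ (n - 1)"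
    using V by simp
  \<comment> \<open>Written as a multiple of \<open>r\<close>, so that the powers of
    \<open>r\<close> on both sides cancel and only the ratio \<open>(R - r) / r\<close>
    remains.\<close>
  also have "R + r = ((R - r) / r + 2) * r"
    using r by (simp add: field_simps)
  also have "real n * (3 * r) * (((R - r) / r + 2) * r) ^ (n - 1) = 3 * n * ((R - r) / r + 2) ^ (n - 1) * r ^ n"
    using n by (cases n) (simp_all add: power_mult_distrib)
  finally have "card Y * r ^ n \<le> 32 ^ n * (3 * n * ((R - r) / r + 2) ^ (n - 1)) * r ^ n"
    by (simp add: power_divide field_simps)
  then show ?thesis using r unfolding n_def[symmetric] by (simp add: mult_ac)
qed

lemma annulus_net:
  fixes R r :: real
  assumes r: "0 < r" "r < R"
  obtains Y :: "('a::euclidean_space) set" where "finite Y"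
    "real (card Y) \<le> 3 * DIM('a) * 32 ^ DIM('a) * ((R - r) / r + 2) ^ (DIM('a) - 1)"
    "\<And>y. R - r \<le> norm y \<Longrightarrow> norm y \<le> R \<Longrightarrow> \<exists>z\<in>Y. norm (y - z) \<le> r / 16"
proof -
  let ?A = "{y::'a. R - r \<le> norm y \<and> norm y \<le> R}"
  let ?b = "3 * DIM('a) * 32 ^ DIM('a) * ((R - r) / r + 2) ^ (DIM('a) - 1)"
  obtain Y :: "'a set" where Y: "finite Y" "card Y \<le> nat \<lfloor>?b\<rfloor>" "\<And>x. x \<in> ?A \<Longrightarrow> \<exists>y\<in>Y. dist x y \<le> r / 16"
  proof (rule maximal_separated_subset)
    show "card Y \<le> nat \<lfloor>?b\<rfloor>" if "finite Y" "Y \<subseteq> ?A"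
      "\<forall>x\<in>Y. \<forall>y\<in>Y. x \<noteq> y \<longrightarrow> r / 16 < dist x y" for Y :: "'a set"
      using card_separated_in_annulus[OF that r] by (simp add: le_nat_floor)
  qed (use r in auto)
  have "real (card Y) \<le> real (nat \<lfloor>?b\<rfloor>)" using Y(2) by (rule of_nat_mono)
  also have "\<dots> \<le> ?b" using r by (intro of_nat_floor) simp
  finally show thesis using that Y by (simp add: dist_norm)
qed

section \<open>Measurability\<close>

text \<open>Projections of Borel sets need not be Borel. Here the set is a countable union of
  compact sets, and a continuous image of a compact set is compact.\<close>

lemma borel_projection_locally_closed:
  fixes C U :: "('a::euclidean_space \<times> 'b::euclidean_space) set"
  assumes "closed C" "open U"
  shows "fst ` (C \<inter> U) \<in> sets borel"
proof -
  obtain K where K: "\<And>n::nat. compact (K n)" "\<Union> (range K) = U"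
    using open_Union_compact_subsets[OF \<open>open U\<close>] by metis
  have "fst ` (C \<inter> U) = (\<Union>n. fst ` (C \<inter> K n))" using K(2) by auto
  also have "\<dots> \<in> sets borel"
  proof (intro sets.countable_UN image_subsetI)
    fix n
    have "compact (C \<inter> K n)" using K(1) \<open>closed C\<close> by (metis closed_Int_compact)
    then have "compact (fst ` (C \<inter> K n))" by (intro compact_continuous_image continuous_intros)
    then show "fst ` (C \<inter> K n) \<in> sets borel" by (simp add: borel_closed compact_imp_closed)
  qed
  finally show ?thesis .
qed

lemma borel_measurable_vec:
  fixes f :: "'k::finite \<Rightarrow> 'w \<Rightarrow> 'a::euclidean_space"
  assumes "\<And>k. f k \<in> borel_measurable M"
  shows "(\<lambda>\<omega>. \<chi> k. f k \<omega>) \<in> borel_measurable M"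
  unfolding borel_measurable_euclidean_space[where 'c="'a^'k"]
proof
  fix b :: "'a^'k" assume "b \<in> Basis"
  then obtain k u where b: "b = axis k u" by (auto simp: Basis_vec_def)
  show "(\<lambda>\<omega>. (\<chi> k. f k \<omega>) \<bullet> b) \<in> borel_measurable M"
    unfolding b inner_axis using assms[of k] by simp
qed

text \<open>The index type \<open>'n option\<close> has as many elements as a facet has vertices.\<close>

type_synonym 'n tuple = "((real^'n) \<times> real) ^ ('n option)"

text \<open>The coefficients are indexed by positions, not by points, so that they range over a
  Euclidean space. The relation is then a projection of a closed set intersected with the open
  condition \<open>c \<noteq> 0\<close>, and a repeated spatial coordinate counts as
  dependence.\<close>

definition spatially_dependent :: "('n::finite) tuple \<Rightarrow> bool" where
  "spatially_dependent x \<longleftrightarrow>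
     (\<exists>c::real^('n option). (\<Sum>k\<in>UNIV. c $ k) = 0 \<and> (\<Sum>k\<in>UNIV. c $ k *\<^sub>R fst (x $ k)) = 0 \<and> c \<noteq> 0)"

definition on_common_paraboloid :: "('n::finite) tuple \<Rightarrow> bool" where
  "on_common_paraboloid x \<longleftrightarrow> (\<exists>p. \<forall>k. x $ k \<in> paraboloid p)"

text \<open>The existential form exhibits the relation as a projection. For a spatially independent
  tuple at most one apex qualifies, so no ambiguity arises where it is applied.\<close>

definition lies_below :: "('n::finite) tuple \<Rightarrow> (real^'n) \<times> real \<Rightarrow> bool" where
  "lies_below x y \<longleftrightarrow> (\<exists>p. (\<forall>k. x $ k \<in> paraboloid p) \<and> y \<in> below_paraboloid p)"

lemma in_paraboloid_iff: "z \<in> paraboloid p \<longleftrightarrow> snd z = snd p - (norm (fst z - fst p))\<^sup>2"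
  by (simp add: paraboloid_def case_prod_beta)

lemma in_below_paraboloid_iff: "z \<in> below_paraboloid p \<longleftrightarrow> snd z < snd p - (norm (fst z - fst p))\<^sup>2"
  by (simp add: below_paraboloid_def case_prod_beta)

section \<open>Borel conditions on tuples of vertices\<close>

lemma sets_spatially_dependent: "{x :: ('n::finite) tuple. spatially_dependent x} \<in> sets borel"
proof -
  let ?C = "{z :: 'n tuple \<times> (real^('n option)).
    (\<Sum>k\<in>UNIV. snd z $ k) = 0 \<and> (\<Sum>k\<in>UNIV. snd z $ k *\<^sub>R fst (fst z $ k)) = 0}"
  let ?U = "{z :: 'n tuple \<times> (real^('n option)). snd z \<noteq> 0}"
  have "closed ?C" by (intro closed_Collect_conj closed_Collect_eq continuous_intros)
  moreover have "open ?U" by (intro open_Collect_neq continuous_intros)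
  moreover have "{x :: 'n tuple. spatially_dependent x} = fst ` (?C \<inter> ?U)"
    by (auto simp: set_eq_iff image_iff Bex_def split_paired_Ex spatially_dependent_def)
  ultimately show ?thesis by (simp only: borel_projection_locally_closed)
qed

lemma sets_on_common_paraboloid: "{x :: ('n::finite) tuple. on_common_paraboloid x} \<in> sets borel"
proof -
  let ?C = "{z :: 'n tuple \<times> ((real^'n) \<times> real).
    \<forall>k. snd (fst z $ k) = snd (snd z) - (norm (fst (fst z $ k) - fst (snd z)))\<^sup>2}"
  have "closed ?C" by (intro closed_Collect_all closed_Collect_eq continuous_intros)
  moreover have "{x :: 'n tuple. on_common_paraboloid x} = fst ` (?C \<inter> UNIV)"
    by (auto simp: set_eq_iff image_iff Bex_def split_paired_Ex on_common_paraboloid_def in_paraboloid_iff)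
  ultimately show ?thesis by (simp only: borel_projection_locally_closed open_UNIV)
qed

lemma sets_lies_below: "{(x :: ('n::finite) tuple, y). lies_below x y} \<in> sets borel"
proof -
  let ?C = "{z :: ('n tuple \<times> ((real^'n) \<times> real)) \<times> ((real^'n) \<times> real).
    \<forall>k. snd (fst (fst z) $ k) = snd (snd z) - (norm (fst (fst (fst z) $ k) - fst (snd z)))\<^sup>2}"
  let ?U = "{z :: ('n tuple \<times> ((real^'n) \<times> real)) \<times> ((real^'n) \<times> real).
    snd (snd (fst z)) < snd (snd z) - (norm (fst (snd (fst z)) - fst (snd z)))\<^sup>2}"
  have "closed ?C" by (intro closed_Collect_all closed_Collect_eq continuous_intros)
  moreover have "open ?U" by (intro open_Collect_less continuous_intros)
  moreover have "{(x :: 'n tuple, y). lies_below x y} = fst ` (?C \<inter> ?U)"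
    by (auto simp: set_eq_iff image_iff Bex_def split_paired_Ex lies_below_def in_paraboloid_iff in_below_paraboloid_iff)
  ultimately show ?thesis by (simp only: borel_projection_locally_closed)
qed

text \<open>Two equal spatial coordinates carry the affine relation with coefficients 1 and
  -1.\<close>

lemma spatially_independent_inj:
  assumes "\<not> spatially_dependent (x :: ('n::finite) tuple)"
  shows "inj (\<lambda>k. fst (x $ k))"
proof (rule injI, rule ccontr)
  fix j k assume eq: "fst (x $ j) = fst (x $ k)" and "j \<noteq> k"
  define c :: "real^('n option)" where "c = (\<chi> i. of_bool (i = j) - of_bool (i = k))"
  have "(\<Sum>i\<in>UNIV. c $ i) = 0"
    by (simp add: c_def sum_subtractf of_bool_def)
  moreover have "of_bool b *\<^sub>R v = (if b then v else 0)" for b and v :: "real^'n" by simp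
  then have "(\<Sum>i\<in>UNIV. c $ i *\<^sub>R fst (x $ i)) = 0"
    using eq by (simp add: c_def scaleR_left_diff_distrib sum_subtractf)
  moreover have "c $ j \<noteq> 0" using \<open>j \<noteq> k\<close> by (simp add: c_def)
  then have "c \<noteq> 0" by auto
  ultimately show False using assms unfolding spatially_dependent_def by blast
qed

lemma spatially_dependent_iff:
  assumes inj: "inj (\<lambda>k. fst ((x :: ('n::finite) tuple) $ k))"
  shows "spatially_dependent x \<longleftrightarrow> affine_dependent (range (\<lambda>k. fst (x $ k)))"
proof -
  let ?v = "\<lambda>k. fst (x $ k)"
  have "affine_dependent (range ?v) \<longleftrightarrow> (\<exists>U. sum U (range ?v) = 0 \<and> (\<exists>v\<in>range ?v. U v \<noteq> 0) \<and>
      (\<Sum>v\<in>range ?v. U v *\<^sub>R v) = 0)"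
    by (rule affine_dependent_explicit_finite) simp
  also have "\<dots> \<longleftrightarrow> (\<exists>U. (\<Sum>k\<in>UNIV. U (?v k)) = 0 \<and> (\<exists>k. U (?v k) \<noteq> 0) \<and>
      (\<Sum>k\<in>UNIV. U (?v k) *\<^sub>R ?v k) = 0)"
    by (simp add: sum.reindex[OF inj] o_def)
  also have "\<dots> \<longleftrightarrow> spatially_dependent x"
  proof
    assume "\<exists>U. (\<Sum>k\<in>UNIV. U (?v k)) = 0 \<and> (\<exists>k. U (?v k) \<noteq> 0) \<and> (\<Sum>k\<in>UNIV. U (?v k) *\<^sub>R ?v k) = 0"
    then obtain U where "(\<Sum>k\<in>UNIV. U (?v k)) = 0" "\<exists>k. U (?v k) \<noteq> 0" "(\<Sum>k\<in>UNIV. U (?v k) *\<^sub>R ?v k) = 0"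
      by blast
    then show "spatially_dependent x"
      unfolding spatially_dependent_def by (intro exI[of _ "\<chi> k. U (?v k)"]) (auto simp: vec_eq_iff)
  next
    assume "spatially_dependent x"
    then obtain c :: "real^('n option)" where c: "(\<Sum>k\<in>UNIV. c $ k) = 0"
      "(\<Sum>k\<in>UNIV. c $ k *\<^sub>R ?v k) = 0" "c \<noteq> 0"
      unfolding spatially_dependent_def by blast
    then show "\<exists>U. (\<Sum>k\<in>UNIV. U (?v k)) = 0 \<and> (\<exists>k. U (?v k) \<noteq> 0) \<and> (\<Sum>k\<in>UNIV. U (?v k) *\<^sub>R ?v k) = 0"
      using inv_f_f[OF inj] by (intro exI[of _ "\<lambda>v. c $ inv ?v v"]) (auto simp: vec_eq_iff)
  qed
  finally show ?thesis by blast
qed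

text \<open>Subtracting the equations of the two paraboloids cancels the quadratic terms. The
  remaining affine equation \<open>w \<bullet> v = b\<close> holds on a set whose affine hull is the
  whole space, which forces \<open>w = 0\<close>.\<close>

lemma apex_unique:
  assumes dep: "\<not> spatially_dependent (x :: ('n::finite) tuple)"
    and p: "\<And>k. x $ k \<in> paraboloid p" and q: "\<And>k. x $ k \<in> paraboloid q"
  shows "p = q"
proof -
  let ?V = "range (\<lambda>k. fst (x $ k))"
  have inj: "inj (\<lambda>k. fst (x $ k))" by (rule spatially_independent_inj[OF dep])
  have "card ?V = CARD('n option)" using card_image[OF inj] by simp
  then have "affine hull ?V = (UNIV :: (real^'n) set)"
    using dep spatially_dependent_iff[OF inj] by (intro affine_independent_span_eq) simp_all
  define w where "w = fst q - fst p"
  define b where "b = (snd q - (norm (fst q))\<^sup>2 - (snd p - (norm (fst p))\<^sup>2)) / - 2"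
  have "w \<bullet> fst (x $ k) = b" for k
  proof -
    have "snd p - (norm (fst (x $ k) - fst p))\<^sup>2 = snd q - (norm (fst (x $ k) - fst q))\<^sup>2"
      using p[of k] q[of k] by (simp add: in_paraboloid_iff)
    then show ?thesis
      unfolding power2_norm_eq_inner w_def b_def
      by (simp add: inner_diff_left inner_diff_right inner_commute field_simps)
  qed
  then have "?V \<subseteq> {v. w \<bullet> v = b}" by auto
  then have "affine hull ?V \<subseteq> {v. w \<bullet> v = b}" by (intro hull_minimal affine_hyperplane)
  then have all: "\<And>v. w \<bullet> v = b" using \<open>affine hull ?V = UNIV\<close> by auto
  \<comment> \<open>The point 0 gives \<open>b = 0\<close>, and then the point \<open>w\<close>
    gives the claim.\<close>
  have "w \<bullet> w = 0" using all[of w] all[of 0] by simp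
  then have "fst p = fst q" by (simp add: w_def)
  moreover from this have "snd p = snd q" using p q by (simp add: in_paraboloid_iff)
  ultimately show ?thesis by (simp add: prod_eq_iff)
qed

text \<open>Collects the conditions that involve the vertices alone. Emptiness below the paraboloid
  is kept apart, since it involves every point of the process.\<close>

definition spanning_tuple :: "real \<Rightarrow> real \<Rightarrow> ('n::finite) tuple \<Rightarrow> bool" where
  "spanning_tuple R s x \<longleftrightarrow> \<not> spatially_dependent x \<and> on_common_paraboloid x \<and>
     (\<exists>k. R < norm (fst (x $ k))) \<and> (\<exists>k. norm (fst (x $ k)) \<le> s)"

lemma sets_spanning_tuple: "{x :: ('n::finite) tuple. spanning_tuple R s x} \<in> sets borel"
proof -
  note [measurable] = sets_spatially_dependent sets_on_common_paraboloid
  have "open {x :: 'n tuple. \<exists>k. R < norm (fst (x $ k))}"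
    by (intro open_Collect_ex open_Collect_less continuous_intros)
  moreover have "{x :: 'n tuple. \<exists>k. norm (fst (x $ k)) \<le> s} = (\<Union>k. {x. norm (fst (x $ k)) \<le> s})"
    by auto
  moreover have "closed (\<Union>k. {x :: 'n tuple. norm (fst (x $ k)) \<le> s})"
    by (auto intro!: closed_UN closed_Collect_le continuous_intros)
  ultimately have [measurable]: "{x :: 'n tuple. \<exists>k. R < norm (fst (x $ k))} \<in> sets borel"
     "{x :: 'n tuple. \<exists>k. norm (fst (x $ k)) \<le> s} \<in> sets borel"
    by auto
  have "{x :: 'n tuple. spanning_tuple R s x} = (- {x. spatially_dependent x}) \<inter> {x. on_common_paraboloid x} \<inter>
     {x. \<exists>k. R < norm (fst (x $ k))} \<inter> {x. \<exists>k. norm (fst (x $ k)) \<le> s}"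
    by (auto simp: spanning_tuple_def)
  also have "\<dots> \<in> sets borel"
    by (intro sets.Int borel_comp) measurable
  finally show ?thesis .
qed

text \<open>The set \<open>F\<close> is determined by \<open>X\<close> and the apex, and reaching
  outside the ball is a condition on the vertices, so the quantifiers over sets become one
  quantifier over tuples of points. For a countable \<open>P\<close> this is a countable
  union.\<close>

lemma ex_facet_iff_ex_tuple:
  fixes P :: "((real^'n::finite) \<times> real) set"
  shows "(\<exists>X F. paraboloid_facet P X F \<and> F \<inter> ((- cball 0 R) \<times> UNIV) \<noteq> {} \<and> (\<exists>(v, h)\<in>X. v \<in> cball 0 s))
    \<longleftrightarrow> (\<exists>x. (\<forall>k. x $ k \<in> P) \<and> spanning_tuple R s x \<and> (\<forall>y\<in>P. \<not> lies_below x y))" (is "?L \<longleftrightarrow> ?R")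
proof
  assume ?L
  then obtain X F where "paraboloid_facet P X F \<and> F \<inter> ((- cball 0 R) \<times> UNIV) \<noteq> {} \<and>
      (\<exists>(v, h)\<in>X. v \<in> cball 0 s)" by (elim exE)
  then have facet: "paraboloid_facet P X F" and hits: "F \<inter> ((- cball 0 R) \<times> UNIV) \<noteq> {}"
    and "\<exists>v\<in>X. fst v \<in> cball 0 s" by (simp_all add: case_prod_beta)
  then obtain v where v: "v \<in> X" "norm (fst v) \<le> s" by auto
  obtain p where X: "X \<subseteq> P" "card X = CARD('n) + 1" "\<not> affine_dependent (fst ` X)"
    and p: "X \<subseteq> paraboloid p" "P \<inter> below_paraboloid p = {}"
    and F: "F = paraboloid p \<inter> (convex hull (fst ` X)) \<times> UNIV"
    using facet unfolding paraboloid_facet_iff by blast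
  have "finite X" using X(2) by (metis card.infinite add_is_0 one_neq_zero)
  then obtain f where f: "bij_betw f (UNIV :: 'n option set) X"
    using finite_same_card_bij[of "UNIV :: 'n option set" X] X(2) by auto
  then have rf: "range f = X" and "inj f" by (auto simp: bij_betw_def)
  define x :: "'n tuple" where "x = (\<chi> k. f k)"
  have xX: "x $ k \<in> X" for k using rf by (auto simp: x_def)
  have "inj_on fst X"
  proof (rule inj_onI)
    fix y z assume "y \<in> X" "z \<in> X" and eq: "fst y = fst z"
    then have "y \<in> paraboloid p" "z \<in> paraboloid p" using p(1) by blast+
    then show "y = z" using eq by (simp add: prod_eq_iff in_paraboloid_iff)
  qed
  then have inj: "inj (\<lambda>k. fst (x $ k))"
    using \<open>inj f\<close> rf comp_inj_on[of f UNIV fst] by (simp add: x_def o_def)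
  have "range (\<lambda>k. fst (x $ k)) = fst ` X" unfolding rf[symmetric] by (auto simp: x_def)
  then have dep: "\<not> spatially_dependent x" using X(3) spatially_dependent_iff[OF inj] by simp
  have xp: "x $ k \<in> paraboloid p" for k using xX p(1) by blast
  have "\<exists>z\<in>X. R < norm (fst z)" using hits facet_hits_outside_iff[OF F] by (rule iffD1[rotated])
  moreover have "X = range (($) x)" using rf by (auto simp: x_def)
  ultimately have "(\<exists>k. R < norm (fst (x $ k))) \<and> (\<exists>k. norm (fst (x $ k)) \<le> s)"
    using v by auto
  then have "spanning_tuple R s x"
    unfolding spanning_tuple_def on_common_paraboloid_def using dep xp by blast
  moreover have "\<not> lies_below x y" if "y \<in> P" for y
  proof
    assume "lies_below x y"
    then obtain q where "\<forall>k. x $ k \<in> paraboloid q" "y \<in> below_paraboloid q"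
      unfolding lies_below_def by blast
    \<comment> \<open>Uniqueness of the apex turns "below some paraboloid through the tuple" into
      "below the paraboloid of the facet".\<close>
    moreover from this have "q = p" by (intro apex_unique[OF dep]) (simp_all add: xp)
    ultimately show False using p(2) that by blast
  qed
  ultimately show ?R using xX X(1) by (intro exI[of _ x]) blast
next
  assume ?R
  then obtain x where xP: "\<And>k. x $ k \<in> P" and x: "spanning_tuple R s x" and below: "\<forall>y\<in>P. \<not> lies_below x y"
    by blast
  obtain p where p: "\<And>k. x $ k \<in> paraboloid p"
    using x unfolding spanning_tuple_def on_common_paraboloid_def by blast
  have dep: "\<not> spatially_dependent x" using x by (simp add: spanning_tuple_def)
  note inj = spatially_independent_inj[OF dep]
  define X where "X = range (($) x)"
  define F where "F = paraboloid p \<inter> (convex hull (fst ` X)) \<times> UNIV"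
  have fX: "fst ` X = range (\<lambda>k. fst (x $ k))" by (auto simp: X_def)
  have "inj (($) x)" using inj by (auto simp: inj_def)
  then have "card X = CARD('n) + 1" unfolding X_def by (simp add: card_image)
  moreover have "\<not> affine_dependent (fst ` X)" unfolding fX using dep spatially_dependent_iff[OF inj] by simp
  moreover have "lies_below x y" if "y \<in> below_paraboloid p" for y
    unfolding lies_below_def using p that by (intro exI[of _ p]) simp
  then have "P \<inter> below_paraboloid p = {}" using below by blast
  ultimately have "paraboloid_facet P X F"
    unfolding paraboloid_facet_iff F_def using xP p
    by (intro conjI exI[of _ p]) (simp_all add: X_def image_subset_iff)
  moreover have "F \<inter> ((- cball 0 R) \<times> UNIV) \<noteq> {}"
    using x unfolding facet_hits_outside_iff[OF F_def] by (auto simp: X_def spanning_tuple_def)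
  moreover have "\<exists>(v, h)\<in>X. v \<in> cball 0 s"
    using x by (auto simp: X_def spanning_tuple_def case_prod_beta)
  ultimately show ?L by (intro exI[of _ X] exI[of _ F]) simp
qed

section \<open>Counts and measurable enumeration of a random set\<close>

lemma num_points_eq_0_iff: "num_points \<xi> B \<omega> = 0 \<longleftrightarrow> \<xi> \<omega> \<inter> B = {}"
  unfolding num_points_def by (subst emeasure_count_space_eq_0) auto

lemma num_points_eq_1_iff: "num_points \<xi> B \<omega> = 1 \<longleftrightarrow> (\<exists>z. \<xi> \<omega> \<inter> B = {z})"
proof
  assume *: "num_points \<xi> B \<omega> = 1"
  have "finite (\<xi> \<omega> \<inter> B)"
  proof (rule ccontr)
    assume "infinite (\<xi> \<omega> \<inter> B)"
    then show False using * by (simp add: num_points_def)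
  qed
  then have "card (\<xi> \<omega> \<inter> B) = 1" using * unfolding num_points_def by simp
  then show "\<exists>z. \<xi> \<omega> \<inter> B = {z}" by (simp add: card_1_singleton_iff)
qed (auto simp: num_points_def)

lemma num_points_less_top_iff: "num_points \<xi> B \<omega> < top \<longleftrightarrow> finite (\<xi> \<omega> \<inter> B)"
  unfolding num_points_def by (cases "finite (\<xi> \<omega> \<inter> B)") (auto simp: of_nat_less_top)

text \<open>The enumeration lists the points that are alone in some member of a countable basis.\<close>

lemma measurable_enumeration:
  fixes \<xi> :: "'w \<Rightarrow> ('a::{second_countable_topology, t1_space}) set"
  assumes count: "\<And>B. B \<in> sets borel \<Longrightarrow> num_points \<xi> B \<in> borel_measurable M"
  obtains A :: "nat \<Rightarrow> 'w set" and Z :: "nat \<Rightarrow> 'w \<Rightarrow> 'a" where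
    "\<And>i. A i \<in> sets M" "\<And>i. Z i \<in> borel_measurable M"
    "\<And>\<omega>. \<omega> \<in> space M \<Longrightarrow> (\<And>x. x \<in> \<xi> \<omega> \<Longrightarrow> \<exists>U. open U \<and> x \<in> U \<and> finite (\<xi> \<omega> \<inter> U)) \<Longrightarrow>
       \<xi> \<omega> = {Z i \<omega> |i. \<omega> \<in> A i}"
proof -
  obtain B :: "'a set set" where B: "countable B" "topological_basis B"
    using ex_countable_basis by blast
  \<comment> \<open>The empty set is added so that the family is certainly nonempty and
    \<open>from_nat_into\<close> enumerates precisely this family.\<close>
  define b where "b = from_nat_into (insert {} B)"
  have "topological_basis (insert {} B)"
  proof (rule topological_basisI)
    show "open b" if "b \<in> insert {} B" for b using that topological_basis_open[OF B(2)] by auto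
    show "\<exists>b\<in>insert {} B. x \<in> b \<and> b \<subseteq> U" if "open U" "x \<in> U" for x U
    proof -
      obtain b where "b \<in> B" "x \<in> b" "b \<subseteq> U"
        using \<open>open U\<close> \<open>x \<in> U\<close> by (elim topological_basisE[OF B(2)])
      then show ?thesis by blast
    qed
  qed
  then have b: "topological_basis (range b)"
    unfolding b_def using B(1) by (simp add: range_from_nat_into)
  have bb [measurable]: "b i \<in> sets borel" for i
    using topological_basis_open[OF b] by (auto intro: borel_open)
  define A where "A i = {\<omega>\<in>space M. num_points \<xi> (b i) \<omega> = 1}" for i
  \<comment> \<open>Outside \<open>A i\<close> the value is a fixed constant, which keeps
    \<open>Z i\<close> measurable on all of \<open>M\<close>.\<close>
  define Z where "Z i \<omega> = (if num_points \<xi> (b i) \<omega> = 1 then THE z. \<xi> \<omega> \<inter> b i = {z} else undefined)" for i \<omega>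
  have Z: "\<xi> \<omega> \<inter> b i = {Z i \<omega>}" if one: "num_points \<xi> (b i) \<omega> = 1" for i \<omega>
  proof -
    obtain z where z: "\<xi> \<omega> \<inter> b i = {z}" using one unfolding num_points_eq_1_iff by blast
    then have "(THE z. \<xi> \<omega> \<inter> b i = {z}) = z" by (intro the_equality) auto
    then show ?thesis using z one by (simp add: Z_def)
  qed
  have A: "A i \<in> sets M" for i
    unfolding A_def using count[OF bb[of i]] by measurable
  show thesis
  proof (rule that[of A Z])
    show "A i \<in> sets M" for i by (rule A)
    show "Z i \<in> borel_measurable M" for i
    proof (rule measurableI)
      fix B :: "'a set" assume B [measurable]: "B \<in> sets borel"
      have "{\<omega>\<in>space M. num_points \<xi> (b i \<inter> B) \<omega> = 1} \<in> sets M"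
        using count[of "b i \<inter> B"] by measurable
      \<comment> \<open>When the only point in \<open>b i\<close> is \<open>Z i \<omega>\<close>, it
        lies in \<open>B\<close> exactly if \<open>b i \<inter> B\<close> still contains one point.
        This expresses the preimage by counts; off \<open>A i\<close> the default value
        decides.\<close>
      moreover have "Z i -` B \<inter> space M = (A i \<inter> {\<omega>\<in>space M. num_points \<xi> (b i \<inter> B) \<omega> = 1}) \<union>
          (if undefined \<in> B then space M - A i else {})"
      proof (intro set_eqI)
        fix \<omega>
        show "\<omega> \<in> Z i -` B \<inter> space M \<longleftrightarrow> \<omega> \<in> (A i \<inter> {\<omega>\<in>space M. num_points \<xi> (b i \<inter> B) \<omega> = 1}) \<union>
          (if undefined \<in> B then space M - A i else {})"
        proof (cases "num_points \<xi> (b i) \<omega> = 1")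
          case True
          have "\<xi> \<omega> \<inter> (b i \<inter> B) = {Z i \<omega>} \<inter> B" using Z[OF True] by blast
          then have "num_points \<xi> (b i \<inter> B) \<omega> = 1 \<longleftrightarrow> Z i \<omega> \<in> B"
            unfolding num_points_eq_1_iff by auto
          then show ?thesis using True by (auto simp: A_def)
        next
          case False
          then show ?thesis by (auto simp: A_def Z_def)
        qed
      qed
      ultimately show "Z i -` B \<inter> space M \<in> sets M" using A[of i] by auto
    qed simp
    fix \<omega> assume \<omega>: "\<omega> \<in> space M"
      and iso: "\<And>x. x \<in> \<xi> \<omega> \<Longrightarrow> \<exists>U. open U \<and> x \<in> U \<and> finite (\<xi> \<omega> \<inter> U)"
    show "\<xi> \<omega> = {Z i \<omega> |i. \<omega> \<in> A i}"
    proof (intro equalityI subsetI)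
      fix x assume x: "x \<in> \<xi> \<omega>"
      obtain U where U: "open U" "x \<in> U" "finite (\<xi> \<omega> \<inter> U)" using iso[OF x] by blast
      \<comment> \<open>Removing the other points of the process from \<open>U\<close> keeps it open
        because they are finitely many; a basis member inside then isolates
        \<open>x\<close>.\<close>
      then have "open (U - (\<xi> \<omega> \<inter> U - {x}))" by (intro open_Diff finite_imp_closed) auto
      then obtain B where "B \<in> range b" "x \<in> B" "B \<subseteq> U - (\<xi> \<omega> \<inter> U - {x})"
        by (rule topological_basisE[OF b]) (use U x in auto)
      then obtain i where i: "x \<in> b i" "b i \<subseteq> U - (\<xi> \<omega> \<inter> U - {x})" by blast
      then have "\<xi> \<omega> \<inter> b i = {x}" using x by blast
      then have "num_points \<xi> (b i) \<omega> = 1" by (auto simp: num_points_eq_1_iff)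
      then show "x \<in> {Z i \<omega> |i. \<omega> \<in> A i}" using \<omega> Z[of i \<omega>] \<open>\<xi> \<omega> \<inter> b i = {x}\<close> by (auto simp: A_def)
    next
      fix x assume "x \<in> {Z i \<omega> |i. \<omega> \<in> A i}"
      then show "x \<in> \<xi> \<omega>" using Z by (auto simp: A_def)
    qed
  qed
qed

text \<open>A locally finite random set is almost surely enumerated by measurable functions, and in terms of
  such an enumeration the event is a countable union, over tuples of indices, of Borel conditions.\<close>

lemma not_determined_sets:
  fixes \<xi> :: "'w \<Rightarrow> ((real^'n::finite) \<times> real) set"
  assumes count: "\<And>B. B \<in> sets borel \<Longrightarrow> num_points \<xi> B \<in> borel_measurable M"
    and iso: "AE \<omega> in M. \<forall>x\<in>\<xi> \<omega>. \<exists>U. open U \<and> x \<in> U \<and> finite (\<xi> \<omega> \<inter> U)"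
  shows "not_determined M \<xi> R r \<in> sets (completion M)"
proof -
  obtain A Z where A: "\<And>i::nat. A i \<in> sets M" and Z: "\<And>i. Z i \<in> borel_measurable M"
    and enum: "\<And>\<omega>. \<omega> \<in> space M \<Longrightarrow> (\<And>x. x \<in> \<xi> \<omega> \<Longrightarrow> \<exists>U. open U \<and> x \<in> U \<and> finite (\<xi> \<omega> \<inter> U)) \<Longrightarrow>
       \<xi> \<omega> = {Z i \<omega> |i. \<omega> \<in> A i}"
    by (rule measurable_enumeration[OF count]) blast+
  note [measurable] = A Z sets_spanning_tuple sets_lies_below
  define T where "T i \<omega> = ((\<chi> k. Z (i k) \<omega>) :: 'n tuple)" for i \<omega>
  have T [measurable]: "T i \<in> borel_measurable M" for i
    unfolding T_def by (intro borel_measurable_vec Z)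
  have meas1 [measurable]: "Measurable.pred M (\<lambda>\<omega>. spanning_tuple R (R - r) (T i \<omega>))" for i
    using measurable_sets[OF T sets_spanning_tuple, of i R "R - r"]
    by (simp add: pred_def vimage_def Int_def conj_commute)
  have meas2 [measurable]: "Measurable.pred M (\<lambda>\<omega>. lies_below (T i \<omega>) (Z j \<omega>))" for i j
  proof -
    have "(\<lambda>\<omega>. (T i \<omega>, Z j \<omega>)) \<in> borel_measurable M" by (intro borel_measurable_Pair T Z)
    from measurable_sets[OF this sets_lies_below]
    show ?thesis by (simp add: pred_def vimage_def Int_def conj_commute)
  qed
  define E where "E \<omega> \<longleftrightarrow> (\<exists>i::'n option \<Rightarrow> nat. (\<forall>k. \<omega> \<in> A (i k)) \<and> spanning_tuple R (R - r) (T i \<omega>) \<and>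
      (\<forall>j. \<omega> \<in> A j \<longrightarrow> \<not> lies_below (T i \<omega>) (Z j \<omega>)))" for \<omega>
  have "Measurable.pred M E" unfolding E_def by measurable
  then have E: "Measurable.pred (completion M) E" by (rule measurable_completion)
  \<comment> \<open>The inner equivalence says that \<open>\<omega>\<close> lies in the symmetric
    difference of the event and \<open>E\<close>; a property failing almost everywhere is measurable
    in the completion.\<close>
  have "AE \<omega> in M. \<not> (\<omega> \<in> not_determined M \<xi> R r \<longleftrightarrow> \<not> E \<omega>)"
    using iso AE_space
  proof eventually_elim
    case (elim \<omega>)
    then have \<xi>: "\<xi> \<omega> = {Z i \<omega> |i. \<omega> \<in> A i}" using enum by blast
    have "\<omega> \<in> not_determined M \<xi> R r \<longleftrightarrow>
        (\<exists>x. (\<forall>k. x $ k \<in> \<xi> \<omega>) \<and> spanning_tuple R (R - r) x \<and> (\<forall>y\<in>\<xi> \<omega>. \<not> lies_below x y))"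
      using elim unfolding not_determined_def ex_facet_iff_ex_tuple[symmetric] by simp
    also have "\<dots> \<longleftrightarrow> E \<omega>"
    proof
      assume "\<exists>x. (\<forall>k. x $ k \<in> \<xi> \<omega>) \<and> spanning_tuple R (R - r) x \<and> (\<forall>y\<in>\<xi> \<omega>. \<not> lies_below x y)"
      then obtain x where x: "\<And>k. x $ k \<in> \<xi> \<omega>" "spanning_tuple R (R - r) x" "\<forall>y\<in>\<xi> \<omega>. \<not> lies_below x y"
        by blast
      have "\<forall>k. \<exists>i. \<omega> \<in> A i \<and> x $ k = Z i \<omega>" using x(1) \<xi> by blast
      then obtain i where i: "\<And>k. \<omega> \<in> A (i k) \<and> x $ k = Z (i k) \<omega>" by metis
      have "T i \<omega> = x" using i by (simp add: T_def vec_eq_iff)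
      then show "E \<omega>" unfolding E_def using x(2,3) i \<xi> by blast
    next
      assume "E \<omega>"
      then obtain i where i: "\<And>k. \<omega> \<in> A (i k)" "spanning_tuple R (R - r) (T i \<omega>)"
        "\<And>j. \<omega> \<in> A j \<Longrightarrow> \<not> lies_below (T i \<omega>) (Z j \<omega>)"
        unfolding E_def by blast
      then show "\<exists>x. (\<forall>k. x $ k \<in> \<xi> \<omega>) \<and> spanning_tuple R (R - r) x \<and> (\<forall>y\<in>\<xi> \<omega>. \<not> lies_below x y)"
        unfolding \<xi> by (intro exI[of _ "T i \<omega>"]) (auto simp: T_def)
    qed
    finally show ?case by blast
  qed
  then have D: "Measurable.pred (completion M) (\<lambda>\<omega>. \<omega> \<in> not_determined M \<xi> R r \<longleftrightarrow> \<not> E \<omega>)"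
    by (rule sets_completion_AE)
  have s: "{\<omega>\<in>space M. \<omega> \<in> not_determined M \<xi> R r \<longleftrightarrow> \<not> E \<omega>} \<in> sets (completion M)"
    "{\<omega>\<in>space M. E \<omega>} \<in> sets (completion M)"
    using D E by (simp_all add: pred_def)
  \<comment> \<open>The event is recovered as the symmetric difference of \<open>E\<close> with that
    null set.\<close>
  have eq: "not_determined M \<xi> R r =
      ({\<omega>\<in>space M. \<omega> \<in> not_determined M \<xi> R r \<longleftrightarrow> \<not> E \<omega>} - {\<omega>\<in>space M. E \<omega>}) \<union>
      ({\<omega>\<in>space M. E \<omega>} - {\<omega>\<in>space M. \<omega> \<in> not_determined M \<xi> R r \<longleftrightarrow> \<not> E \<omega>})"
    by (auto simp: not_determined_def)
  from sets.Un[OF sets.Diff[OF s] sets.Diff[OF s(2,1)]] show ?thesis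
    by (simp only: eq[symmetric])
qed

section \<open>Probability bounds\<close>

lemma closed_low_region: "closed (low_region r (y :: real^'n::finite))"
proof -
  have "low_region r y = {z. r / 4 \<le> norm (fst z - y) \<and> snd z \<le> - (norm (fst z - y))\<^sup>2 / 16}"
    by (auto simp: low_region_def)
  also have "closed \<dots>" by (auto intro!: closed_Collect_conj closed_Collect_le continuous_intros)
  finally show ?thesis .
qed

lemma sets_low_region [measurable]: "low_region r (y :: real^'n::finite) \<in> sets borel"
  by (intro borel_closed closed_low_region)

lemma borel_Times [intro]:
  fixes A :: "'a::second_countable_topology set" and B :: "'b::second_countable_topology set"
  assumes "A \<in> sets borel" "B \<in> sets borel"
  shows "A \<times> B \<in> sets borel"
  using assms unfolding borel_prod[symmetric] by simp

lemma sets_cylinder [measurable]: "cylinder r (y :: real^'n::finite) \<in> sets borel"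
  unfolding cylinder_def by (intro borel_Times) auto

text \<open>All three intensities depend on the height alone. A process on a half-space fits in by
  letting \<open>g\<close> vanish on the other side.\<close>

definition height_intensity :: "(real \<Rightarrow> real) \<Rightarrow> ((real^'n::finite) \<times> real) measure" where
  "height_intensity g = density lborel (\<lambda>z. ennreal (g (snd z)))"

lemma emeasure_height_intensity:
  fixes B :: "((real^'n::finite) \<times> real) set"
  assumes [measurable]: "g \<in> borel_measurable borel" and B [measurable]: "B \<in> sets borel"
  shows "emeasure (height_intensity g) B = (\<integral>\<^sup>+h. ennreal (g h) * emeasure lborel {x. (x, h) \<in> B} \<partial>lborel)"
proof -
  have [measurable]: "(\<lambda>z::(real^'n) \<times> real. g (snd z)) \<in> borel_measurable borel"
    unfolding borel_prod[symmetric] by measurable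
  have B' [measurable]: "B \<in> sets (lborel \<Otimes>\<^sub>M lborel)"
    using B unfolding lborel_prod by simp
  have slice: "{x. (x, h) \<in> B} \<in> sets lborel" for h
    using sets_Pair2[OF B', of h] by (simp add: vimage_def)
  have "emeasure (height_intensity g) B = (\<integral>\<^sup>+z. ennreal (g (snd z)) * indicator B z \<partial>(lborel \<Otimes>\<^sub>M lborel))"
    unfolding height_intensity_def lborel_prod by (subst emeasure_density) auto
  also have "\<dots> = (\<integral>\<^sup>+h. \<integral>\<^sup>+x. ennreal (g h) * indicator B (x, h) \<partial>lborel \<partial>lborel)"
    by (subst lborel_pair.nn_integral_snd[symmetric]) auto
  also have "\<dots> = (\<integral>\<^sup>+h. ennreal (g h) * emeasure lborel {x. (x, h) \<in> B} \<partial>lborel)"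
  proof (intro nn_integral_cong)
    fix h
    have "(\<integral>\<^sup>+x. ennreal (g h) * indicator B (x, h) \<partial>lborel) =
        (\<integral>\<^sup>+x. ennreal (g h) * indicator {x. (x, h) \<in> B} x \<partial>lborel)"
      by (intro nn_integral_cong) (simp add: indicator_def)
    also have "\<dots> = ennreal (g h) * emeasure lborel {x. (x, h) \<in> B}"
      by (rule nn_integral_cmult_indicator[OF slice])
    finally show "(\<integral>\<^sup>+x. ennreal (g h) * indicator B (x, h) \<partial>lborel) = ennreal (g h) * emeasure lborel {x. (x, h) \<in> B}" .
  qed
  finally show ?thesis .
qed

text \<open>Only the slab of the cylinder between heights \<open>a\<close> and \<open>b\<close> is
  counted. Its position is left free: it scales with \<open>r\<^sup>2\<close> for the first and
  third process and is pushed towards height 0 for the second.\<close>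

lemma emeasure_cylinder_ge:
  fixes y :: "real^'n::finite"
  assumes [measurable]: "g \<in> borel_measurable borel" and ab: "a \<le> b" "b < r\<^sup>2 / 16" and "r \<ge> 0"
    and m: "m \<ge> 0" "\<And>h. a \<le> h \<Longrightarrow> h \<le> b \<Longrightarrow> m \<le> g h"
  shows "emeasure (height_intensity g) (cylinder r y) \<ge>
    ennreal (m * (b - a) * (unit_ball_vol (real CARD('n)) * (r / 16) ^ CARD('n)))"
proof -
  let ?V = "ennreal (unit_ball_vol (real CARD('n)) * (r / 16) ^ CARD('n))"
  have V: "emeasure lborel (cball y (r / 16)) = ?V"
    using \<open>r \<ge> 0\<close> by (subst emeasure_cball) auto
  have "ennreal (m * (b - a) * (unit_ball_vol (real CARD('n)) * (r / 16) ^ CARD('n))) = ennreal m * ?V * emeasure lborel {a..b}"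
    using assms by (simp add: ennreal_mult mult_ac)
  also have "\<dots> = (\<integral>\<^sup>+h. ennreal m * ?V * indicator {a..b} h \<partial>lborel)"
    by (subst nn_integral_cmult_indicator) auto
  also have "\<dots> \<le> (\<integral>\<^sup>+h. ennreal (g h) * emeasure lborel {x. (x, h) \<in> cylinder r y} \<partial>lborel)"
  proof (intro nn_integral_mono)
    fix h
    show "ennreal m * ?V * indicator {a..b} h \<le> ennreal (g h) * emeasure lborel {x. (x, h) \<in> cylinder r y}"
    proof (cases "h \<in> {a..b}")
      case True
      then have "{x. (x, h) \<in> cylinder r y} = cball y (r / 16)"
        using ab by (auto simp: cylinder_def)
      then show ?thesis using True m by (simp add: V mult_right_mono ennreal_leI)
    qed simp
  qed
  also have "\<dots> = emeasure (height_intensity g) (cylinder r y)"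
    by (rule emeasure_height_intensity[symmetric]) measurable
  finally show ?thesis .
qed

text \<open>At depth \<open>t\<close> the region lies within distance \<open>4 * sqrt t\<close> of
  the axis. It also keeps distance \<open>r / 4\<close> from the axis, so the slice is empty unless
  \<open>t \<ge> r\<^sup>2 / 256\<close>.\<close>

lemma emeasure_low_region_le:
  fixes y :: "real^'n::finite"
  assumes [measurable]: "g \<in> borel_measurable borel" and "r > 0"
  shows "emeasure (height_intensity g) (low_region r y) \<le>
    (\<integral>\<^sup>+t. ennreal (g (- t) * (unit_ball_vol (real CARD('n)) * (4 * sqrt t) ^ CARD('n))) * indicator {r\<^sup>2 / 256..} t \<partial>lborel)"
proof -
  let ?V = "\<lambda>t. unit_ball_vol (real CARD('n)) * (4 * sqrt t) ^ CARD('n)"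
  have slice: "emeasure lborel {x. (x, h) \<in> low_region r y} \<le> ennreal (?V (- h)) * indicator {r\<^sup>2 / 256..} (- h)" for h
  proof (cases "h \<le> - (r\<^sup>2 / 256)")
    case True
    then have "h \<le> 0" using zero_le_power2[of r] by linarith
    have "{x. (x, h) \<in> low_region r y} \<subseteq> cball y (4 * sqrt (- h))"
    proof
      fix x assume "x \<in> {x. (x, h) \<in> low_region r y}"
      then have "(norm (x - y))\<^sup>2 \<le> 16 * - h" by (simp add: low_region_def)
      then have "(norm (x - y))\<^sup>2 \<le> (4 * sqrt (- h))\<^sup>2"
        using \<open>h \<le> 0\<close> by (simp add: power_mult_distrib)
      then have "norm (x - y) \<le> 4 * sqrt (- h)" by (rule power2_le_imp_le) (use \<open>h \<le> 0\<close> in simp)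
      then show "x \<in> cball y (4 * sqrt (- h))" by (simp add: dist_norm norm_minus_commute)
    qed
    then have "emeasure lborel {x. (x, h) \<in> low_region r y} \<le> emeasure lborel (cball y (4 * sqrt (- h)))"
      by (intro emeasure_mono) auto
    also have "\<dots> = ennreal (?V (- h))" using \<open>h \<le> 0\<close> by (subst emeasure_cball) auto
    finally show ?thesis using True by (simp add: indicator_def)
  next
    case False
    have "{x. (x, h) \<in> low_region r y} = {}"
    proof safe
      fix x assume "(x, h) \<in> low_region r y"
      then have "r / 4 \<le> norm (x - y)" and *: "h \<le> - (norm (x - y))\<^sup>2 / 16" by (auto simp: low_region_def)
      then have "(r / 4)\<^sup>2 \<le> (norm (x - y))\<^sup>2" using \<open>r > 0\<close> by (intro power_mono) auto
      moreover have "(r / 4)\<^sup>2 = r\<^sup>2 / 16" by (simp add: power2_eq_square)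
      ultimately show "x \<in> {}" using * False by linarith
    qed
    then show ?thesis by simp
  qed
  have "emeasure (height_intensity g) (low_region r y) = (\<integral>\<^sup>+h. ennreal (g h) * emeasure lborel {x. (x, h) \<in> low_region r y} \<partial>lborel)"
    by (rule emeasure_height_intensity) measurable
  also have "\<dots> \<le> (\<integral>\<^sup>+h. ennreal (g h) * (ennreal (?V (- h)) * indicator {r\<^sup>2 / 256..} (- h)) \<partial>lborel)"
    by (intro nn_integral_mono mult_left_mono slice) auto
  also have "\<dots> = (\<integral>\<^sup>+t. ennreal (g (- t)) * (ennreal (?V t) * indicator {r\<^sup>2 / 256..} t) \<partial>lborel)"
    by (subst nn_integral_real_affine[where c = "-1" and t = 0]) auto
  also have "\<dots> = (\<integral>\<^sup>+t. ennreal (g (- t) * ?V t) * indicator {r\<^sup>2 / 256..} t \<partial>lborel)"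
  proof (intro nn_integral_cong)
    fix t :: real
    show "ennreal (g (- t)) * (ennreal (?V t) * indicator {r\<^sup>2 / 256..} t) = ennreal (g (- t) * ?V t) * indicator {r\<^sup>2 / 256..} t"
    proof (cases "t \<in> {r\<^sup>2 / 256..}")
      case True
      then have "r\<^sup>2 / 256 \<le> t" by simp
      then have "t \<ge> 0" using zero_le_power2[of r] by linarith
      then show ?thesis by (simp add: ennreal_mult'' mult_ac split: split_indicator)
    qed simp
  qed
  finally show ?thesis .
qed

text \<open>A density may blow up at height 0: \<open>h powr \<beta>\<close> for negative
  \<open>\<beta>\<close>, and always for the second process. Local boundedness is therefore asked
  only elsewhere; the single level 0 has intensity zero and almost surely carries no point.\<close>

locale height_poisson_process = prob_space M for M :: "'w measure" +
  fixes g :: "real \<Rightarrow> real" and \<xi> :: "'w \<Rightarrow> ((real^'n::finite) \<times> real) set"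
  assumes g [measurable]: "g \<in> borel_measurable borel"
    and g_locally_bounded: "\<And>h. h \<noteq> 0 \<Longrightarrow> \<exists>e>0. \<exists>K. \<forall>t. \<bar>t - h\<bar> < e \<longrightarrow> g t \<le> K"
    and count: "\<And>B. B \<in> sets borel \<Longrightarrow> num_points \<xi> B \<in> borel_measurable M"
    and prob_count: "\<And>B k. B \<in> sets borel \<Longrightarrow> emeasure (height_intensity g) B < \<infinity> \<Longrightarrow>
      prob {\<omega>\<in>space M. num_points \<xi> B \<omega> = of_nat k} =
        measure (height_intensity g) B ^ k / fact k * exp (- measure (height_intensity g) B)"
    and infinite_count: "\<And>B. B \<in> sets borel \<Longrightarrow> emeasure (height_intensity g) B = \<infinity> \<Longrightarrow>
      AE \<omega> in M. num_points \<xi> B \<omega> = \<infinity>"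
begin

lemma count_sets: "B \<in> sets borel \<Longrightarrow> {\<omega>\<in>space M. num_points \<xi> B \<omega> = c} \<in> events"
  using measurable_sets[OF count, of B "{c}"] by (simp add: vimage_def Int_def conj_commute)

text \<open>Infinite intensity is included, where emptiness has probability zero. So is negative
  \<open>m\<close>, where the bound exceeds 1; this case does occur for the second process.\<close>

lemma prob_no_points_le:
  assumes B: "B \<in> sets borel" and m: "ennreal m \<le> emeasure (height_intensity g) B"
  shows "prob {\<omega>\<in>space M. num_points \<xi> B \<omega> = 0} \<le> exp (- m)"
proof (cases "emeasure (height_intensity g) B = \<infinity>")
  case True
  then have "AE \<omega> in M. \<omega> \<notin> {\<omega>\<in>space M. num_points \<xi> B \<omega> = 0}"
    using infinite_count[OF B] by (auto elim!: eventually_mono)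
  then have "prob {\<omega>\<in>space M. num_points \<xi> B \<omega> = 0} = 0" using prob_eq_0 count_sets[OF B] by blast
  then show ?thesis by simp
next
  case False
  then have fin: "emeasure (height_intensity g) B < \<infinity>" by (simp add: top.not_eq_extremum)
  then have "ennreal m \<le> ennreal (measure (height_intensity g) B)"
    using m by (simp add: emeasure_eq_ennreal_measure)
  then have "m \<le> measure (height_intensity g) B"
    by (metis ennreal_le_iff measure_nonneg)
  then show ?thesis using prob_count[OF B fin, of 0] by simp
qed

lemma prob_some_point_le:
  assumes B: "B \<in> sets borel" and l: "emeasure (height_intensity g) B \<le> ennreal l" "0 \<le> l"
  shows "prob {\<omega>\<in>space M. num_points \<xi> B \<omega> \<noteq> 0} \<le> l"
proof -
  let ?\<mu> = "measure (height_intensity g) B"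
  have fin: "emeasure (height_intensity g) B < \<infinity>"
    using l(1) by (rule le_less_trans) simp
  have "?\<mu> \<le> l" using l fin by (simp add: measure_def enn2real_leI)
  have "{\<omega>\<in>space M. num_points \<xi> B \<omega> \<noteq> 0} = space M - {\<omega>\<in>space M. num_points \<xi> B \<omega> = of_nat 0}"
    by auto
  then have "prob {\<omega>\<in>space M. num_points \<xi> B \<omega> \<noteq> 0} = 1 - exp (- ?\<mu>)"
    using prob_count[OF B fin, of 0] prob_compl[OF count_sets[OF B, of 0]] by simp
  also have "\<dots> \<le> ?\<mu>" using exp_ge_add_one_self[of "- ?\<mu>"] by linarith
  finally show ?thesis using \<open>?\<mu> \<le> l\<close> by linarith
qed

text \<open>The Poisson weights of the finite counts sum to 1, leaving no mass for an infinite
  count.\<close>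

lemma AE_finite_count:
  assumes B: "B \<in> sets borel" and fin: "emeasure (height_intensity g) B < \<infinity>"
  shows "AE \<omega> in M. finite (\<xi> \<omega> \<inter> B)"
proof -
  let ?\<mu> = "measure (height_intensity g) B"
  let ?E = "\<lambda>k::nat. {\<omega>\<in>space M. num_points \<xi> B \<omega> = of_nat k}"
  have E: "?E k \<in> events" for k by (rule count_sets[OF B])
  have "disjoint_family ?E" by (auto simp: disjoint_family_on_def)
  then have "(\<lambda>k. prob (?E k)) sums prob (\<Union>k. ?E k)"
    using E by (intro finite_measure_UNION) auto
  moreover have "(\<lambda>k. prob (?E k)) = (\<lambda>k. exp (- ?\<mu>) * (?\<mu> ^ k /\<^sub>R fact k))"
    unfolding prob_count[OF B fin] by (simp add: field_simps)
  moreover have "(\<lambda>k. exp (- ?\<mu>) * (?\<mu> ^ k /\<^sub>R fact k)) sums (exp (- ?\<mu>) * exp ?\<mu>)"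
    by (intro sums_mult exp_converges)
  ultimately have "prob (\<Union>k. ?E k) = 1" by (simp add: sums_iff exp_minus)
  then have "AE \<omega> in M. \<omega> \<in> (\<Union>k. ?E k)"
    using E by (intro AE_in_set_eq_1[THEN iffD2]) auto
  then show ?thesis
  proof eventually_elim
    case (elim \<omega>)
    then have "num_points \<xi> B \<omega> < top" by (auto simp: of_nat_less_top)
    then show ?case by (simp only: num_points_less_top_iff)
  qed
qed

lemma finite_intensity_neighbourhood:
  assumes "snd z \<noteq> 0"
  shows "\<exists>U. open U \<and> z \<in> U \<and> emeasure (height_intensity g) (U :: ((real^'n) \<times> real) set) < \<infinity>"
proof -
  obtain e K where e: "e > 0" "\<And>t. \<bar>t - snd z\<bar> < e \<Longrightarrow> g t \<le> K"
    using g_locally_bounded[OF assms] by blast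
  let ?U = "ball (fst z) 1 \<times> ball (snd z) e"
  have V: "emeasure lborel (ball (fst z) 1) < \<infinity>" "emeasure lborel (ball (snd z) e) < \<infinity>"
    using e by (auto simp: emeasure_ball)
  have U [measurable]: "?U \<in> sets borel" by (intro borel_Times) auto
  have "emeasure (height_intensity g) ?U = (\<integral>\<^sup>+h. ennreal (g h) * emeasure lborel {x. (x, h) \<in> ?U} \<partial>lborel)"
    by (rule emeasure_height_intensity) measurable
  also have "\<dots> \<le> (\<integral>\<^sup>+h. (ennreal K * emeasure lborel (ball (fst z) 1)) * indicator (ball (snd z) e) h \<partial>lborel)"
  proof (intro nn_integral_mono)
    fix h
    show "ennreal (g h) * emeasure lborel {x. (x, h) \<in> ?U} \<le>
        (ennreal K * emeasure lborel (ball (fst z) 1)) * indicator (ball (snd z) e) h"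
    proof (cases "h \<in> ball (snd z) e")
      case True
      then have "{x. (x, h) \<in> ?U} = ball (fst z) 1" by auto
      moreover have "g h \<le> K" using e(2)[of h] True by (simp add: dist_real_def abs_minus_commute)
      ultimately show ?thesis using True by (simp add: mult_right_mono ennreal_leI)
    next
      case False
      then have "{x. (x, h) \<in> ?U} = {}" by auto
      then show ?thesis by (simp only: emeasure_empty mult_zero_right zero_le)
    qed
  qed
  also have "\<dots> = (ennreal K * emeasure lborel (ball (fst z) 1)) * emeasure lborel (ball (snd z) e)"
    by (rule nn_integral_cmult_indicator) simp
  also have "\<dots> < \<infinity>" using V by (simp add: ennreal_mult_less_top)
  finally show ?thesis using e(1) by (intro exI[of _ ?U]) (auto simp: mem_Times_iff open_Times)
qed

text \<open>A neighbourhood is needed only around points of the process. Almost surely none of them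
  has height 0, and countably many basic open sets of finite intensity cover all other
  heights.\<close>

lemma AE_locally_finite: "AE \<omega> in M. \<forall>x\<in>\<xi> \<omega>. \<exists>U. open U \<and> x \<in> U \<and> finite (\<xi> \<omega> \<inter> U)"
proof -
  obtain \<B> :: "((real^'n) \<times> real) set set" where \<B>: "countable \<B>" "topological_basis \<B>"
    using ex_countable_basis by blast
  have "AE \<omega> in M. \<forall>U\<in>\<B>. emeasure (height_intensity g) U < \<infinity> \<longrightarrow> finite (\<xi> \<omega> \<inter> U)"
    unfolding AE_ball_countable[OF \<B>(1)]
  proof
    fix U assume "U \<in> \<B>"
    then have "U \<in> sets borel" using topological_basis_open[OF \<B>(2)] by (intro borel_open) blast
    then show "AE \<omega> in M. emeasure (height_intensity g) U < \<infinity> \<longrightarrow> finite (\<xi> \<omega> \<inter> U)"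
      by (cases "emeasure (height_intensity g) U < \<infinity>") (simp_all add: AE_finite_count)
  qed
  moreover have "AE \<omega> in M. \<xi> \<omega> \<inter> UNIV \<times> {0} = {}"
  proof -
    have B: "UNIV \<times> {0::real} \<in> sets (borel :: ((real^'n) \<times> real) measure)" by (intro borel_Times) auto
    have "emeasure (height_intensity g) (UNIV \<times> {0} :: ((real^'n) \<times> real) set) =
        (\<integral>\<^sup>+h. ennreal (g h) * emeasure lborel {x::real^'n. (x, h) \<in> UNIV \<times> {0}} \<partial>lborel)"
      by (rule emeasure_height_intensity[OF g B])
    also have "AE h in lborel. ennreal (g h) * emeasure lborel {x::real^'n. (x, h) \<in> UNIV \<times> {0}} = 0"
      using AE_lborel_singleton[of 0] by eventually_elim simp
    then have "(\<integral>\<^sup>+h. ennreal (g h) * emeasure lborel {x::real^'n. (x, h) \<in> UNIV \<times> {0}} \<partial>lborel) = (\<integral>\<^sup>+h. 0 \<partial>(lborel :: real measure))"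
      by (rule nn_integral_cong_AE)
    finally have "emeasure (height_intensity g) (UNIV \<times> {0} :: ((real^'n) \<times> real) set) = 0" by simp
    then have "prob {\<omega>\<in>space M. num_points \<xi> (UNIV \<times> {0}) \<omega> \<noteq> 0} = 0"
      using prob_some_point_le[OF B, of 0] by (simp add: order_antisym)
    moreover have "{\<omega>\<in>space M. num_points \<xi> (UNIV \<times> {0}) \<omega> \<noteq> 0} \<in> events"
      using sets.compl_sets[OF count_sets[OF B, of 0]] by (rule back_subst[of "\<lambda>A. A \<in> events"]) auto
    ultimately have "AE \<omega> in M. \<omega> \<notin> {\<omega>\<in>space M. num_points \<xi> (UNIV \<times> {0}) \<omega> \<noteq> 0}"
      using prob_eq_0 by blast
    then show ?thesis using AE_space by eventually_elim (simp add: num_points_eq_0_iff)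
  qed
  ultimately show ?thesis
  proof eventually_elim
    case (elim \<omega>)
    show ?case
    proof
      fix x assume x: "x \<in> \<xi> \<omega>"
      then have "snd x \<noteq> 0" using elim(2) by (cases x) auto
      then obtain U where U: "open U" "x \<in> U" "emeasure (height_intensity g) U < \<infinity>"
        using finite_intensity_neighbourhood by blast
      obtain b where b: "b \<in> \<B>" "x \<in> b" "b \<subseteq> U" using U(1,2) by (elim topological_basisE[OF \<B>(2)])
      have "emeasure (height_intensity g) b \<le> emeasure (height_intensity g) U"
        using b U by (intro emeasure_mono) (auto simp: height_intensity_def intro: borel_open)
      then have "finite (\<xi> \<omega> \<inter> b)" using elim(1) b U(3) by (meson le_less_trans)
      then show "\<exists>U. open U \<and> x \<in> U \<and> finite (\<xi> \<omega> \<inter> U)"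
        using b topological_basis_open[OF \<B>(2)] by blast
    qed
  qed
qed

lemma not_determined_prob_le:
  assumes r: "0 < r" "r < R"
    and m: "\<And>z. ennreal m \<le> emeasure (height_intensity g) (cylinder r (z :: real^'n))"
    and l: "\<And>z. emeasure (height_intensity g) (low_region r (z :: real^'n)) \<le> ennreal l" "0 \<le> l"
  shows "measure (completion M) (not_determined M \<xi> R r) \<le>
    3 * CARD('n) * 32 ^ CARD('n) * ((R - r) / r + 2) ^ (CARD('n) - 1) * (exp (- m) + l)"
proof -
  obtain Y :: "(real^'n) set" where Y: "finite Y"
    "real (card Y) \<le> 3 * DIM(real^'n) * 32 ^ DIM(real^'n) * ((R - r) / r + 2) ^ (DIM(real^'n) - 1)"
    and net: "\<And>y. R - r \<le> norm y \<Longrightarrow> norm y \<le> R \<Longrightarrow> \<exists>z\<in>Y. norm (y - z) \<le> r / 16"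
    by (rule annulus_net[OF r]) blast
  define E where "E z = {\<omega>\<in>space M. num_points \<xi> (cylinder r z) \<omega> = 0} \<union>
      {\<omega>\<in>space M. num_points \<xi> (low_region r z) \<omega> \<noteq> 0}" for z :: "real^'n"
  have ev: "{\<omega>\<in>space M. num_points \<xi> (low_region r z) \<omega> \<noteq> 0} \<in> events" for z :: "real^'n"
    using sets.compl_sets[OF count_sets[OF sets_low_region, of r z 0]]
    by (rule back_subst[of "\<lambda>A. A \<in> events"]) auto
  have E: "E z \<in> events" for z
    unfolding E_def by (intro sets.Un ev count_sets) measurable
  have nd: "not_determined M \<xi> R r \<subseteq> (\<Union>z\<in>Y. E z)"
  proof
    fix \<omega> assume "\<omega> \<in> not_determined M \<xi> R r"
    then obtain X F v h where *: "\<omega> \<in> space M" "paraboloid_facet (\<xi> \<omega>) X F"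
      "F \<inter> ((- cball 0 R) \<times> UNIV) \<noteq> {}" "(v, h) \<in> X" "v \<in> cball 0 (R - r)"
      unfolding not_determined_def by blast
    obtain z where "z \<in> Y" "\<xi> \<omega> \<inter> cylinder r z = {} \<or> \<xi> \<omega> \<inter> low_region r z \<noteq> {}"
      using facet_forces_empty_cylinder_or_low_point[OF *(2-5) r(1) net] by blast
    then show "\<omega> \<in> (\<Union>z\<in>Y. E z)" using *(1) by (auto simp: E_def num_points_eq_0_iff)
  qed
  \<comment> \<open>Monotonicity is applied in the completion, where the event lives; the union of
    the \<open>E z\<close> already belongs to \<open>M\<close>, so its two measures agree.\<close>
  have "measure (completion M) (not_determined M \<xi> R r) \<le> measure (completion M) (\<Union>z\<in>Y. E z)"
  proof -
    interpret c: prob_space "completion M" by (rule prob_space_completion)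
    show ?thesis using nd E Y(1) by (intro c.finite_measure_mono) auto
  qed
  also have "\<dots> = prob (\<Union>z\<in>Y. E z)" using E Y(1) by (intro measure_completion) auto
  also have "\<dots> \<le> (\<Sum>z\<in>Y. prob (E z))"
    using E Y(1) by (intro finite_measure_subadditive_finite) auto
  also have "\<dots> \<le> (\<Sum>z\<in>Y. exp (- m) + l)"
  proof (intro sum_mono)
    fix z
    have "prob (E z) \<le> prob {\<omega>\<in>space M. num_points \<xi> (cylinder r z) \<omega> = 0} +
        prob {\<omega>\<in>space M. num_points \<xi> (low_region r z) \<omega> \<noteq> 0}"
      unfolding E_def by (intro measure_Un_le ev count_sets) measurable
    also have "\<dots> \<le> exp (- m) + l"
      by (intro add_mono prob_no_points_le prob_some_point_le m l) measurable
    finally show "prob (E z) \<le> exp (- m) + l" .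
  qed
  also have "\<dots> = card Y * (exp (- m) + l)" by simp
  also have "\<dots> \<le> 3 * DIM(real^'n) * 32 ^ DIM(real^'n) * ((R - r) / r + 2) ^ (DIM(real^'n) - 1) * (exp (- m) + l)"
    using Y(2) l(2) by (intro mult_right_mono) auto
  finally show ?thesis by simp
qed

lemma not_determined_measurable: "not_determined M \<xi> R r \<in> sets (completion M)"
  by (rule not_determined_sets[OF count AE_locally_finite])

end

section \<open>From Poisson processes to the bounds with a net constant\<close>

lemma poisson_processD:
  assumes "poisson_process M \<mu> \<xi>"
  shows "prob_space M" "\<omega> \<in> space M \<Longrightarrow> \<xi> \<omega> \<subseteq> space \<mu>"
    "B \<in> sets \<mu> \<Longrightarrow> num_points \<xi> B \<in> borel_measurable M"
    "B \<in> sets \<mu> \<Longrightarrow> emeasure \<mu> B < \<infinity> \<Longrightarrow> measure M {\<omega>\<in>space M. num_points \<xi> B \<omega> = of_nat k} =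
       measure \<mu> B ^ k / fact k * exp (- measure \<mu> B)"
    "B \<in> sets \<mu> \<Longrightarrow> emeasure \<mu> B = \<infinity> \<Longrightarrow> AE \<omega> in M. num_points \<xi> B \<omega> = \<infinity>"
  using assms unfolding poisson_process_def by simp_all

text \<open>The process takes its points in \<open>S\<close>, so counts on \<open>B\<close> and on
  \<open>B \<inter> S\<close> agree; the intensities agree as well because \<open>g\<close> vanishes
  off \<open>S\<close>.\<close>

lemma height_poisson_processI:
  fixes \<xi> :: "'w \<Rightarrow> ((real^'n::finite) \<times> real) set"
  assumes P: "poisson_process M (density (restrict_space lborel S) f) \<xi>"
    and S: "S \<in> sets borel" and g [measurable]: "g \<in> borel_measurable borel"
    and f: "\<And>z. z \<in> S \<Longrightarrow> f z = ennreal (g (snd z))" and g0: "\<And>z. z \<notin> S \<Longrightarrow> g (snd z) = 0"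
    and bdd: "\<And>h. h \<noteq> 0 \<Longrightarrow> \<exists>e>0. \<exists>K. \<forall>t. \<bar>t - h\<bar> < e \<longrightarrow> g t \<le> K"
  shows "height_poisson_process M g \<xi>"
proof -
  let ?\<mu> = "density (restrict_space lborel S) f"
  have gm [measurable]: "(\<lambda>z::(real^'n) \<times> real. ennreal (g (snd z))) \<in> borel_measurable borel"
    unfolding borel_prod[symmetric] by measurable
  have fm: "f \<in> borel_measurable (restrict_space lborel S)"
  proof (rule measurable_cong[THEN iffD2])
    show "(\<lambda>z. ennreal (g (snd z))) \<in> borel_measurable (restrict_space lborel S)"
      by (intro measurable_restrict_space1) simp
  qed (simp add: f space_restrict_space)
  have sets: "B \<inter> S \<in> sets ?\<mu>" if "B \<in> sets borel" for B
    using that S by (auto simp: sets_restrict_space)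
  have em: "emeasure ?\<mu> (B \<inter> S) = emeasure (height_intensity g) B" if B [measurable]: "B \<in> sets borel" for B
  proof -
    have "emeasure ?\<mu> (B \<inter> S) = (\<integral>\<^sup>+z. f z * indicator (B \<inter> S) z \<partial>restrict_space lborel S)"
      using sets[OF B] by (intro emeasure_density fm) simp
    also have "\<dots> = (\<integral>\<^sup>+z. f z * indicator (B \<inter> S) z * indicator S z \<partial>lborel)"
      using S by (intro nn_integral_restrict_space) simp
    also have "\<dots> = (\<integral>\<^sup>+z. ennreal (g (snd z)) * indicator B z \<partial>lborel)"
    proof (intro nn_integral_cong)
      fix z show "f z * indicator (B \<inter> S) z * indicator S z = ennreal (g (snd z)) * indicator B z"
        by (cases "z \<in> S") (simp_all add: f g0 indicator_inter_arith)
    qed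
    also have "\<dots> = emeasure (height_intensity g) B"
      unfolding height_intensity_def by (rule emeasure_density[symmetric]) auto
    finally show ?thesis .
  qed
  have np: "num_points \<xi> B \<omega> = num_points \<xi> (B \<inter> S) \<omega>" if "\<omega> \<in> space M" for B \<omega>
  proof -
    have "\<xi> \<omega> \<subseteq> S" using poisson_processD(2)[OF P that] by (simp add: space_restrict_space)
    then have "\<xi> \<omega> \<inter> B = \<xi> \<omega> \<inter> (B \<inter> S)" by blast
    then show ?thesis by (simp add: num_points_def)
  qed
  have "prob_space M" by (rule poisson_processD[OF P])
  then interpret prob_space M .
  show ?thesis
  proof
    show "g \<in> borel_measurable borel" by (rule g)
    show "\<exists>e>0. \<exists>K. \<forall>t. \<bar>t - h\<bar> < e \<longrightarrow> g t \<le> K" if "h \<noteq> 0" for h by (rule bdd[OF that])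
    fix B :: "((real^'n) \<times> real) set" assume B: "B \<in> sets borel"
    have "num_points \<xi> (B \<inter> S) \<in> borel_measurable M"
      by (rule poisson_processD(3)[OF P sets[OF B]])
    then show "num_points \<xi> B \<in> borel_measurable M"
      by (rule measurable_cong[THEN iffD2, rotated]) (rule np)
    show "prob {\<omega>\<in>space M. num_points \<xi> B \<omega> = of_nat k} =
        measure (height_intensity g) B ^ k / fact k * exp (- measure (height_intensity g) B)"
      if fin: "emeasure (height_intensity g) B < \<infinity>" for k
    proof -
      have "emeasure ?\<mu> (B \<inter> S) < \<infinity>" using fin em[OF B] by simp
      then have "prob {\<omega>\<in>space M. num_points \<xi> (B \<inter> S) \<omega> = of_nat k} =
          measure ?\<mu> (B \<inter> S) ^ k / fact k * exp (- measure ?\<mu> (B \<inter> S))"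
        by (rule poisson_processD(4)[OF P sets[OF B]])
      moreover have "measure ?\<mu> (B \<inter> S) = measure (height_intensity g) B" by (simp add: measure_def em[OF B])
      moreover have "{\<omega>\<in>space M. num_points \<xi> (B \<inter> S) \<omega> = of_nat k} = {\<omega>\<in>space M. num_points \<xi> B \<omega> = of_nat k}"
        using np[of _ B] by auto
      ultimately show ?thesis by simp
    qed
    show "AE \<omega> in M. num_points \<xi> B \<omega> = \<infinity>" if "emeasure (height_intensity g) B = \<infinity>"
    proof -
      have "emeasure ?\<mu> (B \<inter> S) = \<infinity>" using that em[OF B] by simp
      then have "AE \<omega> in M. num_points \<xi> (B \<inter> S) \<omega> = \<infinity>"
        by (rule poisson_processD(5)[OF P sets[OF B]])
      then show ?thesis using AE_space by eventually_elim (metis np)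
    qed
  qed
qed

text \<open>With \<open>s = (R - r) / r\<close>, the first power bounds
  \<open>(s + 2) ^ (n - 1)\<close> when \<open>s \<le> 1 / c0\<close>; the second is its ratio to
  \<open>s ^ (n - 1)\<close> at worst when \<open>s > 1 / c0\<close>. The final 1 makes the
  resulting inequalities strict.\<close>

definition net_const :: "nat \<Rightarrow> real \<Rightarrow> real" where
  "net_const n c0 = 3 * n * 32 ^ n * ((1 / c0 + 2) ^ (n - 1) + (1 + 2 * c0) ^ (n - 1)) + 1"

lemma net_const_pos: "c0 > 0 \<Longrightarrow> net_const n c0 > 0"
  unfolding net_const_def by (intro add_nonneg_pos) auto

lemma (in height_poisson_process) event_prob_less_not_determined:
  assumes r: "0 < r" "r < R" and c0: "c0 > 0"
    and m: "\<And>z. ennreal m \<le> emeasure (height_intensity g) (cylinder r (z :: real^'n))"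
    and l: "\<And>z. emeasure (height_intensity g) (low_region r (z :: real^'n)) \<le> ennreal l" "0 \<le> l"
    and q: "exp (- m) + l \<le> q"
  shows "event_prob_less M (not_determined M \<xi> R r)
    (if r \<ge> c0 * (R - r) then net_const CARD('n) c0 * q
     else net_const CARD('n) c0 * q * (R - r) ^ (CARD('n) - 1) * r powr (- real (CARD('n) - 1)))"
proof -
  define n where "n = CARD('n)"
  define s where "s = (R - r) / r"
  have s: "s > 0" using r by (simp add: s_def)
  have q0: "q > 0" using q l(2) exp_gt_zero[of "- m"] by linarith
  let ?K = "3 * real n * 32 ^ n"
  have le: "measure (completion M) (not_determined M \<xi> R r) \<le> ?K * (s + 2) ^ (n - 1) * q"
  proof -
    have "measure (completion M) (not_determined M \<xi> R r) \<le> ?K * (s + 2) ^ (n - 1) * (exp (- m) + l)"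
      using not_determined_prob_le[OF r m l] by (simp add: n_def s_def)
    also have "\<dots> \<le> ?K * (s + 2) ^ (n - 1) * q" using q s by (intro mult_left_mono) auto
    finally show ?thesis .
  qed
  have "measure (completion M) (not_determined M \<xi> R r) <
    (if r \<ge> c0 * (R - r) then net_const n c0 * q
     else net_const n c0 * q * (R - r) ^ (n - 1) * r powr (- real (n - 1)))"
  proof (cases "r \<ge> c0 * (R - r)")
    case True
    then have "s \<le> 1 / c0" using r c0 by (simp add: s_def field_simps)
    then have "?K * (s + 2) ^ (n - 1) \<le> ?K * (1 / c0 + 2) ^ (n - 1)"
      using s by (intro mult_left_mono power_mono) auto
    also have "\<dots> \<le> ?K * ((1 / c0 + 2) ^ (n - 1) + (1 + 2 * c0) ^ (n - 1))"
      using c0 by (intro mult_left_mono) auto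
    finally have "?K * (s + 2) ^ (n - 1) < net_const n c0" by (simp add: net_const_def)
    then have "?K * (s + 2) ^ (n - 1) * q < net_const n c0 * q" using q0 by simp
    then show ?thesis using le True by simp
  next
    case False
    \<comment> \<open>Hence \<open>2 < 2 * c0 * s\<close>, so the summand 2 is absorbed into a
      multiple of \<open>s\<close>.\<close>
    then have "1 < c0 * s" using r c0 by (simp add: s_def field_simps)
    then have "(s + 2) ^ (n - 1) \<le> ((1 + 2 * c0) * s) ^ (n - 1)"
      using s by (intro power_mono) (auto simp: algebra_simps)
    then have "?K * (s + 2) ^ (n - 1) \<le> ?K * ((1 + 2 * c0) * s) ^ (n - 1)"
      by (intro mult_left_mono) auto
    also have "\<dots> = ?K * (1 + 2 * c0) ^ (n - 1) * s ^ (n - 1)" by (simp add: power_mult_distrib)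
    also have "\<dots> \<le> ?K * ((1 / c0 + 2) ^ (n - 1) + (1 + 2 * c0) ^ (n - 1)) * s ^ (n - 1)"
      using c0 s by (intro mult_right_mono mult_left_mono) auto
    also have "\<dots> < net_const n c0 * s ^ (n - 1)" using s by (simp add: net_const_def)
    finally have "?K * (s + 2) ^ (n - 1) * q < net_const n c0 * s ^ (n - 1) * q" using q0 by simp
    also have "s ^ (n - 1) = (R - r) ^ (n - 1) * r powr (- real (n - 1))"
      using r by (simp add: s_def power_divide powr_minus_divide powr_realpow)
    finally show ?thesis using le False by (simp add: mult_ac)
  qed
  then show ?thesis
    using not_determined_measurable unfolding event_prob_less_def n_def by simp
qed

lemma event_prob_less_mono: "event_prob_less M E b \<Longrightarrow> b \<le> b' \<Longrightarrow> event_prob_less M E b'"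
  by (auto simp: event_prob_less_def)

section \<open>The three intensities\<close>

text \<open>The sign of the exponent is left open, so minimum and maximum cover both directions of
  monotonicity.\<close>

lemma powr_between:
  fixes a b t :: real
  assumes "0 < a" "a \<le> t" "t \<le> b"
  shows "min (a powr \<beta>) (b powr \<beta>) \<le> t powr \<beta>" "t powr \<beta> \<le> max (a powr \<beta>) (b powr \<beta>)"
proof (atomize (full), cases "\<beta> \<ge> 0")
  case True
  then have "a powr \<beta> \<le> t powr \<beta>" "t powr \<beta> \<le> b powr \<beta>" using assms by (auto intro: powr_mono2)
  then show "min (a powr \<beta>) (b powr \<beta>) \<le> t powr \<beta> \<and> t powr \<beta> \<le> max (a powr \<beta>) (b powr \<beta>)" by auto
next
  case False
  then have "t powr \<beta> \<le> a powr \<beta>" "b powr \<beta> \<le> t powr \<beta>" using assms by (auto intro!: powr_mono2')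
  then show "min (a powr \<beta>) (b powr \<beta>) \<le> t powr \<beta> \<and> t powr \<beta> \<le> max (a powr \<beta>) (b powr \<beta>)" by auto
qed

lemma powr_locally_bounded:
  fixes h :: real
  assumes "h > 0"
  shows "\<exists>e>0. e \<le> h \<and> (\<exists>K. \<forall>t. \<bar>t - h\<bar> < e \<longrightarrow> t powr \<beta> \<le> K)"
proof (intro exI conjI allI impI)
  fix t assume "\<bar>t - h\<bar> < h / 2"
  then show "t powr \<beta> \<le> max ((h / 2) powr \<beta>) ((2 * h) powr \<beta>)"
    using assms by (intro powr_between) (auto simp: abs_if split: if_splits)
qed (use assms in auto)

definition eta_height :: "real \<Rightarrow> real \<Rightarrow> real \<Rightarrow> real" where
  "eta_height c \<beta> h = (if 0 \<le> h then c * h powr \<beta> else 0)"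

definition eta'_height :: "real \<Rightarrow> real \<Rightarrow> real \<Rightarrow> real" where
  "eta'_height c \<beta> h = (if h \<le> 0 then c * (- h) powr (- \<beta>) else 0)"

definition zeta_height :: "real \<Rightarrow> real \<Rightarrow> real" where
  "zeta_height c h = c * exp (h / 2)"

section \<open>The three processes as instances of the height process\<close>

lemma eta_height_process:
  fixes \<xi> :: "'w \<Rightarrow> ((real^'n::finite) \<times> real) set"
  assumes P: "poisson_process M (eta_intensity \<beta>) \<xi>" and c: "eta_const (CARD('n) + 1) \<beta> > 0"
  shows "height_poisson_process M (eta_height (eta_const (CARD('n) + 1) \<beta>) \<beta>) \<xi>"
proof (rule height_poisson_processI[OF P[unfolded eta_intensity_def]])
  let ?c = "eta_const (CARD('n) + 1) \<beta>"
  show "eta_height ?c \<beta> \<in> borel_measurable borel" unfolding eta_height_def by measurable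
  show "\<exists>e>0. \<exists>K. \<forall>t. \<bar>t - h\<bar> < e \<longrightarrow> eta_height ?c \<beta> t \<le> K" if "h \<noteq> 0" for h
  proof (cases "h > 0")
    case True
    then obtain e K where e: "0 < e" "e \<le> h" "\<And>t. \<bar>t - h\<bar> < e \<Longrightarrow> t powr \<beta> \<le> K"
      using powr_locally_bounded by blast
    have "eta_height ?c \<beta> t \<le> ?c * K" if "\<bar>t - h\<bar> < e" for t
      using e(2) e(3)[OF that] that c by (auto simp: eta_height_def)
    then show ?thesis using e(1) by blast
  next
    case False
    then show ?thesis using \<open>h \<noteq> 0\<close>
      by (intro exI[of _ "- h"] conjI exI[of _ 0]) (auto simp: eta_height_def)
  qed
qed (auto simp: eta_height_def intro: borel_Times)

lemma eta'_height_process: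
  fixes \<xi> :: "'w \<Rightarrow> ((real^'n::finite) \<times> real) set"
  assumes P: "poisson_process M (eta'_intensity \<beta>) \<xi>" and c: "eta'_const (CARD('n) + 1) \<beta> > 0"
  shows "height_poisson_process M (eta'_height (eta'_const (CARD('n) + 1) \<beta>) \<beta>) \<xi>"
proof (rule height_poisson_processI[OF P[unfolded eta'_intensity_def]])
  let ?c = "eta'_const (CARD('n) + 1) \<beta>"
  show "eta'_height ?c \<beta> \<in> borel_measurable borel" unfolding eta'_height_def by measurable
  show "\<exists>e>0. \<exists>K. \<forall>t. \<bar>t - h\<bar> < e \<longrightarrow> eta'_height ?c \<beta> t \<le> K" if "h \<noteq> 0" for h
  proof (cases "h < 0")
    case True
    then have "0 < - h" by simp
    from powr_locally_bounded[OF this, of "- \<beta>"]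
    obtain e K where e: "0 < e" "e \<le> - h" "\<And>t. \<bar>t - - h\<bar> < e \<Longrightarrow> t powr (- \<beta>) \<le> K"
      by blast
    have "eta'_height ?c \<beta> t \<le> ?c * K" if "\<bar>t - h\<bar> < e" for t
      using e(2) e(3)[of "- t"] that c by (auto simp: eta'_height_def)
    then show ?thesis using e(1) by blast
  next
    case False
    then show ?thesis using \<open>h \<noteq> 0\<close>
      by (intro exI[of _ h] conjI exI[of _ 0]) (auto simp: eta'_height_def)
  qed
qed (auto simp: eta'_height_def intro: borel_Times)

lemma restrict_space_UNIV_eq: "restrict_space lborel UNIV = (lborel :: 'a::euclidean_space measure)"
  by (rule measure_eqI) (simp_all add: sets_restrict_space emeasure_restrict_space)

lemma zeta_height_process:
  fixes \<xi> :: "'w \<Rightarrow> ((real^'n::finite) \<times> real) set"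
  assumes P: "poisson_process M zeta_intensity \<xi>"
  shows "height_poisson_process M (zeta_height ((2 * pi) powr (- real (CARD('n) + 1) / 2))) \<xi>"
proof (rule height_poisson_processI[where S = UNIV])
  let ?c = "(2 * pi) powr (- real (CARD('n) + 1) / 2)"
  show "poisson_process M (density (restrict_space lborel UNIV)
      (\<lambda>(v :: real^'n, h). ennreal (?c * exp (h / 2)))) \<xi>"
    using P unfolding zeta_intensity_def restrict_space_UNIV_eq .
  show "zeta_height ?c \<in> borel_measurable borel" unfolding zeta_height_def by measurable
  show "\<exists>e>0. \<exists>K. \<forall>t. \<bar>t - h\<bar> < e \<longrightarrow> zeta_height ?c t \<le> K" for h
    by (intro exI[of _ 1] conjI exI[of _ "?c * exp ((h + 1) / 2)"])
       (auto simp: zeta_height_def intro!: mult_left_mono)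
qed (auto simp: zeta_height_def)

text \<open>The slab runs from \<open>r\<^sup>2 / 32\<close>, half the height of the cylinder, to
  \<open>3 * r\<^sup>2 / 64\<close>. Thickness and density then scale as \<open>r\<^sup>2\<close>
  and \<open>r powr (2 * \<beta>)\<close>, and the base as \<open>r ^ CARD('n)\<close>, which yields
  the exponent.\<close>

lemma eta_cylinder:
  fixes z :: "real^'n::finite" and c r \<beta> :: real
  assumes "c > 0" "r > 0"
  defines "K \<equiv> c * min ((1 / 32) powr \<beta>) ((3 / 64) powr \<beta>) * unit_ball_vol (real CARD('n)) / (64 * 16 ^ CARD('n))"
  shows "ennreal (K * r powr (real CARD('n) + 2 + 2 * \<beta>)) \<le> emeasure (height_intensity (eta_height c \<beta>)) (cylinder r z)"
proof -
  let ?a = "r\<^sup>2 * (1 / 32)" and ?b = "r\<^sup>2 * (3 / 64)"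
  let ?m = "c * min (?a powr \<beta>) (?b powr \<beta>)"
  have "ennreal (?m * (?b - ?a) * (unit_ball_vol (real CARD('n)) * (r / 16) ^ CARD('n)))
      \<le> emeasure (height_intensity (eta_height c \<beta>)) (cylinder r z)"
  proof (rule emeasure_cylinder_ge)
    show "eta_height c \<beta> \<in> borel_measurable borel" unfolding eta_height_def by measurable
    fix h assume h: "?a \<le> h" "h \<le> ?b"
    have a: "?a > 0" using \<open>r > 0\<close> by simp
    then have "h > 0" using h by linarith
    then show "?m \<le> eta_height c \<beta> h"
      using powr_between(1)[OF a h] \<open>c > 0\<close> by (simp add: eta_height_def mult_left_mono)
  qed (use assms in auto)
  also have "?m * (?b - ?a) * (unit_ball_vol (real CARD('n)) * (r / 16) ^ CARD('n)) =
      K * r powr (real CARD('n) + 2 + 2 * \<beta>)"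
  proof -
    have "?a powr \<beta> = (r\<^sup>2) powr \<beta> * (1 / 32) powr \<beta>" "?b powr \<beta> = (r\<^sup>2) powr \<beta> * (3 / 64) powr \<beta>"
      by (rule powr_mult; simp)+
    then have "min (?a powr \<beta>) (?b powr \<beta>) = (r\<^sup>2) powr \<beta> * min ((1 / 32) powr \<beta>) ((3 / 64) powr \<beta>)"
      by (simp only: min_mult_distrib_left powr_ge_zero if_True)
    moreover have "(r\<^sup>2) powr \<beta> = r powr (2 * \<beta>)"
      using \<open>r > 0\<close> by (simp add: powr_powr flip: powr_numeral)
    moreover have "r powr (real CARD('n) + 2 + 2 * \<beta>) = r ^ CARD('n) * r\<^sup>2 * r powr (2 * \<beta>)"
      using \<open>r > 0\<close> by (simp add: powr_add powr_realpow)
    ultimately show ?thesis by (simp add: K_def power_divide)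
  qed
  finally show ?thesis .
qed

lemma eta_low_region:
  fixes z :: "real^'n::finite"
  assumes "r > 0"
  shows "emeasure (height_intensity (eta_height c \<beta>)) (low_region r z) \<le> ennreal 0"
proof -
  have meas: "eta_height c \<beta> \<in> borel_measurable borel" unfolding eta_height_def by measurable
  have "(\<integral>\<^sup>+t. ennreal (eta_height c \<beta> (- t) * (unit_ball_vol (real CARD('n)) * (4 * sqrt t) ^ CARD('n))) *
      indicator {r\<^sup>2 / 256..} t \<partial>lborel) = (\<integral>\<^sup>+t. 0 \<partial>(lborel :: real measure))"
  proof (intro nn_integral_cong)
    fix t :: real
    have "r\<^sup>2 / 256 > 0" using assms by simp
    then have "eta_height c \<beta> (- t) = 0" if "t \<in> {r\<^sup>2 / 256..}"
    proof -
      have "t > 0" using that \<open>r\<^sup>2 / 256 > 0\<close> by (simp only: atLeast_iff)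
      then show ?thesis by (simp add: eta_height_def)
    qed
    then show "ennreal (eta_height c \<beta> (- t) * (unit_ball_vol (real CARD('n)) * (4 * sqrt t) ^ CARD('n))) *
      indicator {r\<^sup>2 / 256..} t = 0" by (cases "t \<in> {r\<^sup>2 / 256..}") simp_all
  qed
  then show ?thesis using emeasure_low_region_le[OF meas assms, of z] by simp
qed

text \<open>The slab between \<open>- e\<close> and \<open>- e / 2\<close> has intensity at least of
  order \<open>e powr (1 - \<beta>)\<close>, which is unbounded as \<open>e\<close> tends to 0 since
  \<open>\<beta> > 1\<close>. Infinite intensity is thus expressed by exceeding every
  \<open>m\<close>.\<close>

lemma eta'_cylinder:
  fixes z :: "real^'n::finite"
  assumes c: "c > 0" and "\<beta> > 1" "r > 0"
  shows "ennreal m \<le> emeasure (height_intensity (eta'_height c \<beta>)) (cylinder r z)"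
proof -
  define W where "W = unit_ball_vol (real CARD('n)) * (r / 16) ^ CARD('n)"
  have W: "W > 0" using \<open>r > 0\<close> by (simp add: W_def)
  \<comment> \<open>Solves \<open>c * w / 2 * W = \<bar>m\<bar> + c * W / 2\<close>; the added 1
    keeps \<open>w\<close> positive when \<open>m = 0\<close>.\<close>
  define w where "w = 2 * \<bar>m\<bar> / (c * W) + 1"
  have w: "w > 0" using c W by (auto simp: w_def intro!: add_nonneg_pos)
  define e where "e = w powr (1 / (1 - \<beta>))"
  have e: "e > 0" using w by (simp add: e_def)
  have "e powr (1 - \<beta>) = w" using \<open>\<beta> > 1\<close> w by (simp add: e_def powr_powr)
  then have ew: "e powr (- \<beta>) * e = w" using e powr_add[of e "- \<beta>" 1] by (simp add: add.commute)
  have "m \<le> \<bar>m\<bar> + c * W / 2" using c W by (simp add: abs_ge_self add_increasing2)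
  also have "\<dots> = c * w / 2 * W" using c W by (simp add: w_def field_simps)
  also have "\<dots> = c * e powr (- \<beta>) * (- e / 2 - - e) * W" by (simp add: ew[symmetric])
  finally have "ennreal m \<le> ennreal (c * e powr (- \<beta>) * (- e / 2 - - e) * W)" by (rule ennreal_leI)
  also have "\<dots> \<le> emeasure (height_intensity (eta'_height c \<beta>)) (cylinder r z)"
    unfolding W_def
  proof (rule emeasure_cylinder_ge)
    show "eta'_height c \<beta> \<in> borel_measurable borel" unfolding eta'_height_def by measurable
    fix h assume h: "- e \<le> h" "h \<le> - e / 2"
    then have "e powr (- \<beta>) \<le> (- h) powr (- \<beta>)" using e \<open>\<beta> > 1\<close> by (intro powr_mono2') auto
    then show "c * e powr (- \<beta>) \<le> eta'_height c \<beta> h" using c h e by (simp add: eta'_height_def)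
  next
    have "- e / 2 < 0" using e by simp
    also have "0 < r\<^sup>2 / 16" using \<open>r > 0\<close> by simp
    finally show "- e / 2 < r\<^sup>2 / 16" .
  qed (use e c \<open>r > 0\<close> in auto)
  finally show ?thesis .
qed

text \<open>The density \<open>t powr (- \<beta>)\<close> times the slice volume, of order
  \<open>t powr (CARD('n) / 2)\<close>, is a multiple of \<open>t powr (- s - 1)\<close>. Its tail
  is integrable because \<open>s > 0\<close>, which is the assumption on
  \<open>\<beta>\<close>.\<close>

lemma eta'_low_region:
  fixes z :: "real^'n::finite" and c r \<beta> :: real
  assumes c: "c > 0" and \<beta>: "\<beta> > real CARD('n) / 2 + 1" and "r > 0"
  defines "s \<equiv> \<beta> - real CARD('n) / 2 - 1"
  defines "L \<equiv> c * unit_ball_vol (real CARD('n)) * 4 ^ CARD('n) * 256 powr s / s"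
  shows "emeasure (height_intensity (eta'_height c \<beta>)) (low_region r z) \<le> ennreal (L * r powr (- (2 * s)))"
proof -
  define n where "n = CARD('n)"
  define A where "A = c * unit_ball_vol (real n) * 4 ^ n"
  have A: "A > 0" using c by (simp add: A_def)
  have s: "s > 0" using \<beta> by (simp add: s_def)
  let ?a = "r\<^sup>2 / 256"
  have a: "?a > 0" using \<open>r > 0\<close> by simp
  have meas: "eta'_height c \<beta> \<in> borel_measurable borel" unfolding eta'_height_def by measurable
  have "emeasure (height_intensity (eta'_height c \<beta>)) (low_region r z) \<le>
      (\<integral>\<^sup>+t. ennreal (eta'_height c \<beta> (- t) * (unit_ball_vol (real n) * (4 * sqrt t) ^ n)) * indicator {?a..} t \<partial>lborel)"
    unfolding n_def by (rule emeasure_low_region_le[OF meas \<open>r > 0\<close>])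
  also have "\<dots> = (\<integral>\<^sup>+t. ennreal (A * t powr (- s - 1)) * indicator {?a..} t \<partial>lborel)"
  proof (intro nn_integral_cong)
    fix t :: real
    show "ennreal (eta'_height c \<beta> (- t) * (unit_ball_vol (real n) * (4 * sqrt t) ^ n)) * indicator {?a..} t =
        ennreal (A * t powr (- s - 1)) * indicator {?a..} t"
    proof (cases "t \<in> {?a..}")
      case True
      then have "t > 0" using a by (simp only: atLeast_iff)
      then have "sqrt t ^ n = t powr (real n / 2)"
        by (simp add: powr_half_sqrt[symmetric] powr_powr flip: powr_realpow)
      moreover have "t powr (- s - 1) = t powr (- \<beta>) * t powr (real n / 2)"
        unfolding powr_add[symmetric] by (simp add: s_def n_def)
      ultimately show ?thesis using \<open>t > 0\<close> by (simp add: eta'_height_def A_def power_mult_distrib mult_ac)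
    qed simp
  qed
  also have "\<dots> = ennreal (0 - - (A / s) * ?a powr (- s))"
  proof (rule nn_integral_FTC_atLeast)
    show "(\<lambda>t. A * t powr (- s - 1)) \<in> borel_measurable borel" by measurable
    fix t assume "?a \<le> t"
    then have "t > 0" using a by linarith
    then show "((\<lambda>t. - (A / s) * t powr (- s)) has_real_derivative A * t powr (- s - 1)) (at t)"
      using s by (auto intro!: derivative_eq_intros simp: field_simps powr_diff)
    show "0 \<le> A * t powr (- s - 1)" using A by simp
  next
    have "((\<lambda>t. t powr (- s)) \<longlongrightarrow> 0) at_top"
      using s by (intro tendsto_neg_powr filterlim_ident) auto
    from tendsto_mult_right_zero[OF this]
    show "((\<lambda>t. - (A / s) * t powr (- s)) \<longlongrightarrow> 0) at_top" .
  qed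
  also have "0 - - (A / s) * ?a powr (- s) = L * r powr (- (2 * s))"
  proof -
    have "?a powr (- s) = 256 powr s * r powr (- (2 * s))"
      using \<open>r > 0\<close> by (simp add: powr_divide powr_minus powr_powr divide_simps flip: powr_numeral)
    then show ?thesis by (simp add: L_def A_def n_def)
  qed
  finally show ?thesis .
qed

text \<open>From height 0 upwards the density is at least \<open>c\<close>. Only the thickness of
  the slab needs to grow with \<open>r\<close>; the base is bounded below by its size at
  \<open>r = 1 / 3\<close>, hence the 48.\<close>

lemma zeta_cylinder:
  fixes z :: "real^'n::finite"
  assumes c: "c > 0" and r: "r \<ge> 1 / 3"
  shows "ennreal (c * unit_ball_vol (real CARD('n)) / (32 * 48 ^ CARD('n)) * r\<^sup>2)
    \<le> emeasure (height_intensity (zeta_height c)) (cylinder r z)"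
proof -
  have "(1 / 48) ^ CARD('n) \<le> (r / 16) ^ CARD('n)" using r by (intro power_mono) auto
  then have "c * (r\<^sup>2 / 32 - 0) * (unit_ball_vol (real CARD('n)) * (1 / 48) ^ CARD('n)) \<le>
      c * (r\<^sup>2 / 32 - 0) * (unit_ball_vol (real CARD('n)) * (r / 16) ^ CARD('n))"
    using c by (intro mult_left_mono) auto
  then have "ennreal (c * unit_ball_vol (real CARD('n)) / (32 * 48 ^ CARD('n)) * r\<^sup>2) \<le>
      ennreal (c * (r\<^sup>2 / 32 - 0) * (unit_ball_vol (real CARD('n)) * (r / 16) ^ CARD('n)))"
    by (intro ennreal_leI) (simp add: power_divide mult_ac)
  also have "\<dots> \<le> emeasure (height_intensity (zeta_height c)) (cylinder r z)"
  proof (rule emeasure_cylinder_ge)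
    show "zeta_height c \<in> borel_measurable borel" unfolding zeta_height_def by measurable
    show "r\<^sup>2 / 32 < r\<^sup>2 / 16" using r by simp
    show "c \<le> zeta_height c h" if "0 \<le> h" for h
      using c that by (simp add: zeta_height_def)
  qed (use c r in auto)
  finally show ?thesis .
qed

text \<open>Half of the decay \<open>exp (- t / 2)\<close> is spent on absorbing the slice volume.
  The other half, integrated from depth \<open>r\<^sup>2 / 256\<close>, leaves the rate
  \<open>1 / (4 * 256)\<close>.\<close>

lemma zeta_low_region:
  fixes z :: "real^'n::finite"
  assumes c: "c > 0" and "r > 0"
  shows "emeasure (height_intensity (zeta_height c)) (low_region r z) \<le>
    ennreal (4 * (c * unit_ball_vol (real CARD('n)) * (16 * real CARD('n)) ^ CARD('n)) * exp (- r\<^sup>2 / 1024))"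
proof -
  define n where "n = CARD('n)"
  have n: "n > 0" by (simp add: n_def)
  define A where "A = c * unit_ball_vol (real n) * (16 * real n) ^ n"
  have A: "A > 0" using c n by (simp add: A_def)
  let ?a = "r\<^sup>2 / 256"
  have a: "?a > 0" using \<open>r > 0\<close> by simp
  have meas: "zeta_height c \<in> borel_measurable borel" unfolding zeta_height_def by measurable
  have "emeasure (height_intensity (zeta_height c)) (low_region r z) \<le>
      (\<integral>\<^sup>+t. ennreal (zeta_height c (- t) * (unit_ball_vol (real n) * (4 * sqrt t) ^ n)) * indicator {?a..} t \<partial>lborel)"
    unfolding n_def by (rule emeasure_low_region_le[OF meas \<open>r > 0\<close>])
  also have "\<dots> \<le> (\<integral>\<^sup>+t. ennreal (A * exp (- t / 4)) * indicator {?a..} t \<partial>lborel)"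
  proof (intro nn_integral_mono)
    fix t :: real
    show "ennreal (zeta_height c (- t) * (unit_ball_vol (real n) * (4 * sqrt t) ^ n)) * indicator {?a..} t
        \<le> ennreal (A * exp (- t / 4)) * indicator {?a..} t"
    proof (cases "t \<in> {?a..}")
      case True
      then have t: "t > 0" using a by (simp only: atLeast_iff)
      have "sqrt t \<le> 1 + t"
        using t by (intro real_le_lsqrt) (auto simp: power2_eq_square algebra_simps)
      \<comment> \<open>Brought into the form required by \<open>(1 + x / n) ^ n \<le> exp x\<close>
        with \<open>x = t / 4\<close>.\<close>
      also have "\<dots> \<le> 4 * real n * (1 + t / 4 / real n)" using n by (simp add: algebra_simps)
      finally have "sqrt t ^ n \<le> (4 * real n * (1 + t / 4 / real n)) ^ n" using t by (intro power_mono) auto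
      also have "\<dots> = (4 * real n) ^ n * (1 + t / 4 / real n) ^ n" by (rule power_mult_distrib)
      also have "\<dots> \<le> (4 * real n) ^ n * exp (t / 4)"
        using n t by (intro mult_left_mono exp_ge_one_plus_x_over_n_power_n) auto
      finally have *: "sqrt t ^ n \<le> (4 * real n) ^ n * exp (t / 4)" .
      have "zeta_height c (- t) * (unit_ball_vol (real n) * (4 * sqrt t) ^ n) =
          (c * unit_ball_vol (real n) * 4 ^ n * exp (- t / 2)) * sqrt t ^ n"
        by (simp add: zeta_height_def power_mult_distrib)
      also have "\<dots> \<le> (c * unit_ball_vol (real n) * 4 ^ n * exp (- t / 2)) * ((4 * real n) ^ n * exp (t / 4))"
        using c by (intro mult_left_mono *) auto
      also have "\<dots> = c * unit_ball_vol (real n) * (4 * (4 * real n)) ^ n * (exp (- t / 2) * exp (t / 4))"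
        unfolding power_mult_distrib by (simp only: mult_ac)
      also have "exp (- t / 2) * exp (t / 4) = exp (- t / 4)" by (simp add: mult_exp_exp)
      also have "c * unit_ball_vol (real n) * (4 * (4 * real n)) ^ n = A" by (simp add: A_def)
      finally show ?thesis by (intro mult_right_mono ennreal_leI) auto
    qed simp
  qed
  also have "\<dots> = ennreal (0 - - (4 * A) * exp (- ?a / 4))"
  proof (rule nn_integral_FTC_atLeast)
    show "(\<lambda>t. A * exp (- t / 4)) \<in> borel_measurable borel" by measurable
    fix t assume "?a \<le> t"
    show "((\<lambda>t. - (4 * A) * exp (- t / 4)) has_real_derivative A * exp (- t / 4)) (at t)"
      by (auto intro!: derivative_eq_intros)
    show "0 \<le> A * exp (- t / 4)" using A by simp
  next
    have "((\<lambda>t::real. exp (- t / 4)) \<longlongrightarrow> 0) at_top" by real_asymp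
    from tendsto_mult_right_zero[OF this]
    show "((\<lambda>t. - (4 * A) * exp (- t / 4)) \<longlongrightarrow> 0) at_top" .
  qed
  also have "0 - - (4 * A) * exp (- ?a / 4) = 4 * A * exp (- r\<^sup>2 / 1024)" by simp
  finally show ?thesis unfolding A_def n_def .
qed


theorem lemma5:
  fixes d :: nat and c0 :: real
  assumes d: "d = CARD('n::finite) + 1" and c0: "c0 > 0"
  shows
    "(\<forall>\<beta>::real. \<beta> > -1 \<longrightarrow>
        (\<exists>c1>0. \<exists>ct1>0. \<exists>c2>0. \<exists>ct2>0.
          \<forall>(M::'w measure) (\<xi>::'w \<Rightarrow> ((real^'n) \<times> real) set).
            poisson_process M (eta_intensity \<beta>) \<xi> \<longrightarrow>
            (\<forall>R r. R - r > 0 \<longrightarrow> r \<ge> 1/3 \<longrightarrow>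
              event_prob_less M (not_determined M \<xi> R r)
                (if r \<ge> c0 * (R - r)
                 then c2 * r * exp (- c1 * r powr (real d + 1 + 2 * \<beta>))
                 else ct2 * (R - r) ^ (d - 2) * r powr (- real d + 3)
                        * exp (- ct1 * r powr (real d + 1 + 2 * \<beta>)))))) \<and>
     (\<forall>\<beta>::real. \<beta> > (real d + 1) / 2 \<longrightarrow>
        (\<exists>c3>0. \<exists>ct3>0.
          \<forall>(M::'w measure) (\<xi>::'w \<Rightarrow> ((real^'n) \<times> real) set).
            poisson_process M (eta'_intensity \<beta>) \<xi> \<longrightarrow>
            (\<forall>R r. R - r > 0 \<longrightarrow> r > 0 \<longrightarrow>
              event_prob_less M (not_determined M \<xi> R r)
                (if r \<ge> c0 * (R - r)
                 then c3 * r powr (- (2 * \<beta> - real d - 1))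
                 else ct3 * (R - r) ^ (d - 2) * r powr (- 2 * \<beta> + 3))))) \<and>
     (\<exists>c4>0. \<exists>ct4>0. \<exists>c5>0. \<exists>ct5>0.
        \<forall>(M::'w measure) (\<xi>::'w \<Rightarrow> ((real^'n) \<times> real) set).
          poisson_process M zeta_intensity \<xi> \<longrightarrow>
          (\<forall>R r. R - r > 0 \<longrightarrow> r \<ge> 1/3 \<longrightarrow>
            event_prob_less M (not_determined M \<xi> R r)
              (if r \<ge> c0 * (R - r)
               then c5 * exp (- c4 * r\<^sup>2)
               else ct5 * (R - r) ^ (d - 2) * r powr (- real d + 2)
                      * exp (- ct4 * r\<^sup>2))))"
proof (intro conjI allI impI)
  define N where "N = net_const CARD('n) c0"
  have N: "N > 0" unfolding N_def by (rule net_const_pos[OF c0])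
  then have N3: "3 * N > 0" by simp
  have d2: "d - 2 = CARD('n) - 1" and dn: "real d = real CARD('n) + 1" using d by auto
  \<comment> \<open>Ensures that the natural subtraction in \<open>d - 2\<close> does not
    truncate.\<close>
  have "d \<ge> 2" using d zero_less_card_finite[where 'a = 'n] by simp
  then have n1: "- real (d - 2) = - real d + 2" by simp
  let ?V = "unit_ball_vol (real CARD('n))"
  have V: "?V > 0" by simp
  {
    fix \<beta> :: real assume \<beta>: "\<beta> > -1"
    define c where "c = eta_const (CARD('n) + 1) \<beta>"
    have "0 \<le> real (CARD('n) + 1) / 2" by simp
    then have "0 < real (CARD('n) + 1) / 2 + \<beta> + 1" using \<beta> by linarith
    then have c: "c > 0" using \<beta> unfolding c_def eta_const_def
      by (intro divide_pos_pos mult_pos_pos Gamma_real_pos) auto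
    define K where "K = c * min ((1 / 32) powr \<beta>) ((3 / 64) powr \<beta>) * ?V / (64 * 16 ^ CARD('n))"
    have K: "K > 0" using c V by (simp add: K_def)
    show "\<exists>c1>0. \<exists>ct1>0. \<exists>c2>0. \<exists>ct2>0. \<forall>(M::'w measure) (\<xi>::'w \<Rightarrow> ((real^'n) \<times> real) set).
            poisson_process M (eta_intensity \<beta>) \<xi> \<longrightarrow>
            (\<forall>R r. R - r > 0 \<longrightarrow> r \<ge> 1/3 \<longrightarrow>
              event_prob_less M (not_determined M \<xi> R r)
                (if r \<ge> c0 * (R - r)
                 then c2 * r * exp (- c1 * r powr (real d + 1 + 2 * \<beta>))
                 else ct2 * (R - r) ^ (d - 2) * r powr (- real d + 3)
                        * exp (- ct1 * r powr (real d + 1 + 2 * \<beta>))))"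
    proof (rule exI[of _ "K"], rule conjI[OF K], rule exI[of _ "K"], rule conjI[OF K],
        rule exI[of _ "3 * N"], rule conjI[OF N3], rule exI[of _ "3 * N"], rule conjI[OF N3], intro allI impI)
      fix M :: "'w measure" and \<xi> :: "'w \<Rightarrow> ((real^'n) \<times> real) set" and R r :: real
      assume P: "poisson_process M (eta_intensity \<beta>) \<xi>" and "R - r > 0" "r \<ge> 1 / 3"
      then have r: "0 < r" "r < R" by auto
      interpret height_poisson_process M "eta_height c \<beta>" \<xi>
        using eta_height_process[OF P] c unfolding c_def by blast
      define q where "q = exp (- (K * r powr (real CARD('n) + 2 + 2 * \<beta>)))"
      have q: "q > 0" by (simp add: q_def)
      have "event_prob_less M (not_determined M \<xi> R r)
          (if r \<ge> c0 * (R - r) then N * q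
           else N * q * (R - r) ^ (CARD('n) - 1) * r powr (- real (CARD('n) - 1)))"
        unfolding N_def
      proof (rule event_prob_less_not_determined[OF r c0])
        show "ennreal (K * r powr (real CARD('n) + 2 + 2 * \<beta>)) \<le>
            emeasure (height_intensity (eta_height c \<beta>)) (cylinder r z)" for z :: "real^'n"
          unfolding K_def by (rule eta_cylinder[OF c r(1)])
        show "emeasure (height_intensity (eta_height c \<beta>)) (low_region r z) \<le> ennreal 0" for z :: "real^'n"
          by (rule eta_low_region[OF r(1)])
      qed (simp_all add: q_def)
      then show "event_prob_less M (not_determined M \<xi> R r)
          (if r \<ge> c0 * (R - r)
           then 3 * N * r * exp (- K * r powr (real d + 1 + 2 * \<beta>))
           else 3 * N * (R - r) ^ (d - 2) * r powr (- real d + 3) * exp (- K * r powr (real d + 1 + 2 * \<beta>)))"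
      proof (rule event_prob_less_mono)
        have e: "exp (- K * r powr (real d + 1 + 2 * \<beta>)) = q"
          by (simp add: q_def dn add.assoc)
        \<comment> \<open>The estimate obtained so far has no factor \<open>r\<close>. Since
          \<open>3 * r \<ge> 1\<close>, it may be inserted at the price of the 3 in the witness
          \<open>3 * N\<close>.\<close>
        have three: "1 \<le> 3 * r" using \<open>r \<ge> 1 / 3\<close> by simp
        have "r powr (- real d + 3) = r powr (- real d + 2) * r"
          using r powr_add[of r "- real d + 2" 1] by simp
        moreover have "N * q * (R - r) ^ (d - 2) * r powr (- real d + 2) * 1 \<le>
            N * q * (R - r) ^ (d - 2) * r powr (- real d + 2) * (3 * r)"
          using three N q r by (intro mult_left_mono mult_nonneg_nonneg) auto
        moreover have "N * q * 1 \<le> N * q * (3 * r)"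
          using three N q by (intro mult_left_mono) auto
        ultimately show "(if r \<ge> c0 * (R - r) then N * q
           else N * q * (R - r) ^ (CARD('n) - 1) * r powr (- real (CARD('n) - 1))) \<le>
          (if r \<ge> c0 * (R - r)
           then 3 * N * r * exp (- K * r powr (real d + 1 + 2 * \<beta>))
           else 3 * N * (R - r) ^ (d - 2) * r powr (- real d + 3) * exp (- K * r powr (real d + 1 + 2 * \<beta>)))"
          unfolding e d2[symmetric] n1 by (simp add: mult_ac)
      qed
    qed
  }
  {
    fix \<beta> :: real assume \<beta>: "\<beta> > (real d + 1) / 2"
    define c where "c = eta'_const (CARD('n) + 1) \<beta>"
    have c: "c > 0" using \<beta> unfolding c_def eta'_const_def dn
      by (intro divide_pos_pos mult_pos_pos Gamma_real_pos) auto
    define s where "s = \<beta> - real CARD('n) / 2 - 1"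
    have s: "s > 0" "\<beta> > real CARD('n) / 2 + 1" "\<beta> > 1" using \<beta> by (auto simp: s_def dn)
    define L where "L = c * ?V * 4 ^ CARD('n) * 256 powr s / s"
    have L: "L > 0" using c V s by (simp add: L_def)
    show "\<exists>c3>0. \<exists>ct3>0. \<forall>(M::'w measure) (\<xi>::'w \<Rightarrow> ((real^'n) \<times> real) set).
            poisson_process M (eta'_intensity \<beta>) \<xi> \<longrightarrow>
            (\<forall>R r. R - r > 0 \<longrightarrow> r > 0 \<longrightarrow>
              event_prob_less M (not_determined M \<xi> R r)
                (if r \<ge> c0 * (R - r)
                 then c3 * r powr (- (2 * \<beta> - real d - 1))
                 else ct3 * (R - r) ^ (d - 2) * r powr (- 2 * \<beta> + 3)))"
    \<comment> \<open>The factor 2 arises because the empty cylinder and the low region are each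
      bounded by the same quantity, \<open>l\<close> below.\<close>
    proof (intro exI[of _ "2 * N * L"] conjI allI impI)
      fix M :: "'w measure" and \<xi> :: "'w \<Rightarrow> ((real^'n) \<times> real) set" and R r :: real
      assume P: "poisson_process M (eta'_intensity \<beta>) \<xi>" and "R - r > 0" and "r > 0"
      then have r: "0 < r" "r < R" by auto
      interpret height_poisson_process M "eta'_height c \<beta>" \<xi>
        using eta'_height_process[OF P] c unfolding c_def by blast
      define l where "l = L * r powr (- (2 * s))"
      have l: "l > 0" using L r by (simp add: l_def)
      \<comment> \<open>The cylinders have infinite intensity, so any \<open>m\<close> is available; this one turns
        \<open>exp (- m)\<close> into \<open>l\<close>.\<close>
      have "event_prob_less M (not_determined M \<xi> R r)
          (if r \<ge> c0 * (R - r) then N * (2 * l)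
           else N * (2 * l) * (R - r) ^ (CARD('n) - 1) * r powr (- real (CARD('n) - 1)))"
        unfolding N_def
      proof (rule event_prob_less_not_determined[OF r c0])
        show "ennreal (- ln l) \<le> emeasure (height_intensity (eta'_height c \<beta>)) (cylinder r z)" for z :: "real^'n"
          by (rule eta'_cylinder[OF c s(3) r(1)])
        show "emeasure (height_intensity (eta'_height c \<beta>)) (low_region r z) \<le> ennreal l" for z :: "real^'n"
          unfolding l_def L_def s_def by (rule eta'_low_region[OF c s(2) r(1)])
      qed (use l in simp_all)
      moreover have "N * (2 * l) = 2 * N * L * r powr (- (2 * \<beta> - real d - 1))"
        by (simp add: l_def s_def dn algebra_simps)
      moreover have "N * (2 * l) * (R - r) ^ (d - 2) * r powr (- real d + 2) =
          2 * N * L * (R - r) ^ (d - 2) * r powr (- 2 * \<beta> + 3)"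
      proof -
        have "r powr (- (2 * s)) * r powr (- real d + 2) = r powr (- 2 * \<beta> + 3)"
          unfolding powr_add[symmetric] by (simp add: s_def dn algebra_simps)
        then show ?thesis by (simp add: l_def mult_ac)
      qed
      ultimately show "event_prob_less M (not_determined M \<xi> R r)
          (if r \<ge> c0 * (R - r)
           then 2 * N * L * r powr (- (2 * \<beta> - real d - 1))
           else 2 * N * L * (R - r) ^ (d - 2) * r powr (- 2 * \<beta> + 3))"
        unfolding d2[symmetric] n1 by (simp only:)
    qed (use L N in auto)
  }
  define c :: real where "c = (2 * pi) powr (- real (CARD('n) + 1) / 2)"
  have c: "c > 0" by (simp add: c_def)
  define K where "K = c * ?V / (32 * 48 ^ CARD('n))"
  have K: "K > 0" using c V by (simp add: K_def)
  define A where "A = 4 * (c * ?V * (16 * real CARD('n)) ^ CARD('n))"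
  have A: "A > 0" using c V by (simp add: A_def)
  \<comment> \<open>A common decay rate: \<open>K\<close> comes from the empty cylinder and
    \<open>1 / 1024\<close> from the low region.\<close>
  define k where "k = min K (1 / 1024)"
  have k: "k > 0" using K by (simp add: k_def)
  have NA: "N * (1 + A) > 0" using N A by simp
  show "\<exists>c4>0. \<exists>ct4>0. \<exists>c5>0. \<exists>ct5>0. \<forall>(M::'w measure) (\<xi>::'w \<Rightarrow> ((real^'n) \<times> real) set).
          poisson_process M zeta_intensity \<xi> \<longrightarrow>
          (\<forall>R r. R - r > 0 \<longrightarrow> r \<ge> 1/3 \<longrightarrow>
            event_prob_less M (not_determined M \<xi> R r)
              (if r \<ge> c0 * (R - r)
               then c5 * exp (- c4 * r\<^sup>2)
               else ct5 * (R - r) ^ (d - 2) * r powr (- real d + 2)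
                      * exp (- ct4 * r\<^sup>2)))"
  proof (rule exI[of _ "k"], rule conjI[OF k], rule exI[of _ "k"], rule conjI[OF k],
      rule exI[of _ "N * (1 + A)"], rule conjI[OF NA], rule exI[of _ "N * (1 + A)"], rule conjI[OF NA], intro allI impI)
    fix M :: "'w measure" and \<xi> :: "'w \<Rightarrow> ((real^'n) \<times> real) set" and R r :: real
    assume P: "poisson_process M zeta_intensity \<xi>" and "R - r > 0" and r3: "r \<ge> 1 / 3"
    then have r: "0 < r" "r < R" by auto
    interpret height_poisson_process M "zeta_height c" \<xi>
      using zeta_height_process[OF P] unfolding c_def .
    define q where "q = (1 + A) * exp (- k * r\<^sup>2)"
    have "event_prob_less M (not_determined M \<xi> R r)
        (if r \<ge> c0 * (R - r) then N * q
         else N * q * (R - r) ^ (CARD('n) - 1) * r powr (- real (CARD('n) - 1)))"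
      unfolding N_def
    proof (rule event_prob_less_not_determined[OF r c0])
      show "ennreal (K * r\<^sup>2) \<le> emeasure (height_intensity (zeta_height c)) (cylinder r z)" for z :: "real^'n"
        unfolding K_def by (rule zeta_cylinder[OF c r3])
      show "emeasure (height_intensity (zeta_height c)) (low_region r z) \<le> ennreal (A * exp (- r\<^sup>2 / 1024))" for z :: "real^'n"
        unfolding A_def by (rule zeta_low_region[OF c r(1)])
      show "0 \<le> A * exp (- r\<^sup>2 / 1024)" using A by simp
      have "k * r\<^sup>2 \<le> K * r\<^sup>2" "k * r\<^sup>2 \<le> 1 / 1024 * r\<^sup>2"
        by (intro mult_right_mono; simp add: k_def)+
      then have "exp (- (K * r\<^sup>2)) \<le> exp (- k * r\<^sup>2)" "A * exp (- r\<^sup>2 / 1024) \<le> A * exp (- k * r\<^sup>2)"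
        using A by auto
      then show "exp (- (K * r\<^sup>2)) + A * exp (- r\<^sup>2 / 1024) \<le> q"
        unfolding q_def distrib_right mult_1 by (rule add_mono)
    qed
    then show "event_prob_less M (not_determined M \<xi> R r)
        (if r \<ge> c0 * (R - r)
         then N * (1 + A) * exp (- k * r\<^sup>2)
         else N * (1 + A) * (R - r) ^ (d - 2) * r powr (- real d + 2) * exp (- k * r\<^sup>2))"
      unfolding d2[symmetric] n1 q_def by (rule event_prob_less_mono) (simp add: mult_ac)
  qed
qed

end
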